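(* Let $\alpha>0$, $\sigma\in\mathbb{R}$, and $1\le p<\infty$. Then $u\in I_{a+}^{\alpha}[L_p(\Omega)]$ if and only if $e^{\sigma x}u(x)\in I_{a+}^{\alpha}[L_p(\Omega)]$. Also, there are positive constants $C_1$ and $C_2$, depending on $\alpha$, $\sigma$, $a$, $b$, such that for $u\in I_{a+}^{\alpha}[L_p(\Omega)]$ $$C_1\|u\|_{I_{a+}^{\alpha}[L_p(\Omega)]}\leq \|e^{\sigma x}u\|_{I_{a+}^{\alpha}[L_p(\Omega)]}\leq C_2 \|u\|_{I_{a+}^{\alpha}[L_p(\Omega)]}.$$ That is, there are positive constants $\tilde{C}_1$ and $\tilde{C}_2$, depending on $\alpha$, $\sigma$, $a$, $b$, such that $$\tilde{C}_1\|{}_{a}D_{x}^{\alpha}u\|_{L_p(\Omega)}\leq \|e^{-\sigma x}\,{}_{a}D_{x}^{\alpha}\left(e^{\sigma x}u\right)\|_{L_p(\Omega)}\leq \tilde{C}_2 \|{}_{a}D_{x}^{\alpha}u\|_{L_p(\Omega)}.$$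
   Context: $\Omega=[a,b]$ is a closed bounded interval, functions are real-valued, $D=\frac{d}{dx}$. For $\beta>0$ and $v\in L_1(\Omega)$, ${}_{a}I_{x}^{\beta}v(x):=\frac{1}{\Gamma(\beta)}\int_{a}^x(x-s)^{\beta-1}v(s)\,ds$. For $n-1\le\alpha<n$, $n$ a positive integer, ${}_{a}D_{x}^{\alpha}u:=D^{n}\,{}_{a}I_{x}^{n-\alpha}u$. $I_{a+}^\alpha[L_p(\Omega)]:=\{{}_{a}I_{x}^\alpha \varphi:\varphi\in L_p(\Omega)\}$, with norm $\|u\|_{I_{a+}^\alpha[L_p(\Omega)]}:=\|\varphi\|_{L_p(\Omega)}=\|{}_{a}D_{x}^\alpha u\|_{L_p(\Omega)}$, where $\varphi$ is the unique element of $L_p(\Omega)$ with $u={}_{a}I_{x}^\alpha\varphi$. The operator $u\mapsto e^{-\sigma x}\,{}_{a}D_{x}^{\alpha}(e^{\sigma x}u)$ is the (left) tempered fractional derivative for $\sigma\ge0$. *)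

theory Defs
  imports "HOL-Analysis.Analysis"
begin

text \<open>
  Elements of \<open>L\<^sub>p[a,b]\<close> are represented by functions on the whole real line; only their values
  on \<open>[a,b]\<close> matter, and only up to Lebesgue-null sets.
\<close>

definition Lp_space :: "real \<Rightarrow> real \<Rightarrow> real \<Rightarrow> (real \<Rightarrow> real) set" where
  "Lp_space p a b =
     {f. f \<in> borel_measurable (lebesgue_on {a..b}) \<and>
         integrable (lebesgue_on {a..b}) (\<lambda>x. \<bar>f x\<bar> powr p)}"

definition Lp_norm :: "real \<Rightarrow> real \<Rightarrow> real \<Rightarrow> (real \<Rightarrow> real) \<Rightarrow> real" where
  "Lp_norm p a b f = (LINT x|lebesgue_on {a..b}. \<bar>f x\<bar> powr p) powr (1 / p)"

definition frac_int :: "real \<Rightarrow> real \<Rightarrow> (real \<Rightarrow> real) \<Rightarrow> real \<Rightarrow> real" where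
  "frac_int a \<beta> v x = 1 / Gamma \<beta> * (LINT s|lebesgue_on {a..x}. (x - s) powr (\<beta> - 1) * v s)"

text \<open>
  For \<open>\<alpha> \<ge> 0\<close>, the \<open>n\<close> below is the unique positive integer with \<open>n - 1 \<le> \<alpha> < n\<close>, so the
  inner integral always has order \<open>n - \<alpha> \<in> (0,1]\<close>. The derivative is the classical pointwise one;
  for functions in the range of the fractional integral it exists almost everywhere on \<open>[a,b]\<close>,
  and \<open>deriv\<close> takes an unspecified value on the exceptional null set.
\<close>

definition frac_deriv :: "real \<Rightarrow> real \<Rightarrow> (real \<Rightarrow> real) \<Rightarrow> real \<Rightarrow> real" where
  "frac_deriv a \<alpha> u =
     (let n = nat \<lfloor>\<alpha>\<rfloor> + 1 in (deriv ^^ n) (frac_int a (real n - \<alpha>) u))"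

definition is_frac_int_of :: "real \<Rightarrow> real \<Rightarrow> real \<Rightarrow> (real \<Rightarrow> real) \<Rightarrow> (real \<Rightarrow> real) \<Rightarrow> bool" where
  "is_frac_int_of a b \<alpha> u \<phi> \<longleftrightarrow> (AE x in lebesgue_on {a..b}. u x = frac_int a \<alpha> \<phi> x)"

definition frac_space :: "real \<Rightarrow> real \<Rightarrow> real \<Rightarrow> real \<Rightarrow> (real \<Rightarrow> real) set" where
  "frac_space a b \<alpha> p = {u. \<exists>\<phi>\<in>Lp_space p a b. is_frac_int_of a b \<alpha> u \<phi>}"

text \<open>
  The density \<open>\<phi>\<close> is unique only up to null sets, so one is chosen; its norm does not depend
  on the choice.
\<close>

definition frac_norm :: "real \<Rightarrow> real \<Rightarrow> real \<Rightarrow> real \<Rightarrow> (real \<Rightarrow> real) \<Rightarrow> real" where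
  "frac_norm a b \<alpha> p u =
     Lp_norm p a b (SOME \<phi>. \<phi> \<in> Lp_space p a b \<and> is_frac_int_of a b \<alpha> u \<phi>)"

definition tempered_deriv :: "real \<Rightarrow> real \<Rightarrow> real \<Rightarrow> (real \<Rightarrow> real) \<Rightarrow> real \<Rightarrow> real" where
  "tempered_deriv a \<alpha> \<sigma> u x = exp (- \<sigma> * x) * frac_deriv a \<alpha> (\<lambda>t. exp (\<sigma> * t) * u t) x"

end

theory Submission
  imports Defs
begin

text \<open>
  Multiplication by \<open>exp (\<sigma> x)\<close> preserves the range of the fractional integral because the tempered
  kernel is the plain kernel convolved with a perturbation of the identity. Write
  \<open>K\<^sub>\<beta> t = t powr (\<beta> - 1) / \<Gamma>(\<beta>)\<close> for \<open>t > 0\<close>, so that the fractional integral of order \<open>\<beta>\<close> is the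
  convolution \<open>K\<^sub>\<beta> \<star> \<phi>\<close> and the Beta integral gives \<open>K\<^sub>\<alpha> \<star> K\<^sub>\<beta> = K\<^sub>\<alpha>\<^sub>+\<^sub>\<beta>\<close>. With \<open>g s = exp (\<sigma> s) \<phi> s\<close>,
  the function \<open>exp (\<sigma> x) (K\<^sub>\<alpha> \<star> \<phi>) x\<close> equals \<open>(exp (\<sigma> t) K\<^sub>\<alpha> t) \<star> g\<close>. Expanding the exponential,
  \<open>exp (\<sigma> t) K\<^sub>\<alpha> t = K\<^sub>\<alpha> t + (\<Sum>j. c\<^sub>j K\<^sub>\<alpha>\<^sub>+\<^sub>j\<^sub>+\<^sub>1 t) = K\<^sub>\<alpha> + K\<^sub>\<alpha> \<star> m\<close> with \<open>m = (\<Sum>j. c\<^sub>j K\<^sub>j\<^sub>+\<^sub>1)\<close>, an entire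
  function cut off at \<open>0\<close> (\<open>conv_temper_kernel\<close>). Associativity of convolution then yields the new
  density \<open>\<psi> = g + m \<star> g\<close> (\<open>tempered_density\<close>). Since \<open>m\<close> is bounded on \<open>[0, b - a]\<close>, the density \<open>\<psi>\<close> is
  dominated pointwise by a multiple of \<open>\<bar>\<phi>\<bar>\<close> plus a multiple of the \<open>L\<^sub>1\<close> norm of \<open>\<phi>\<close>, and hence in
  \<open>L\<^sub>p\<close> norm by a constant that is uniform in \<open>p\<close> (\<open>Lp_norm_dominated\<close>). Replacing \<open>\<sigma>\<close> by \<open>- \<sigma>\<close> gives
  the converse inclusion and the lower bound.

  The norm inequalities refer to densities, and the last part of the theorem to fractional
  derivatives, so the two have to be identified: if \<open>u = K\<^sub>\<alpha> \<star> \<phi>\<close> almost everywhere and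
  \<open>n - 1 \<le> \<alpha> < n\<close>, then the fractional integral of \<open>u\<close> of order \<open>n - \<alpha>\<close> is, at every point of the interval, equal
  to the \<open>n\<close>-fold iterated integral of \<open>\<phi>\<close>. The fundamental theorem of calculus removes \<open>n - 1\<close> of the integrations
  at every interior point, and the last one is removed almost everywhere by Lebesgue's differentiation
  theorem, which is derived here from Vitali's covering theorem (\<open>frac_deriv_frac_int\<close>). In
  particular the density is unique up to null sets, so the choice in the norm is harmless.
\<close>

section \<open>Lebesgue's differentiation theorem on the line\<close>

text \<open>
  These are the points where the upper derivative of the indefinite integral exceeds \<open>r\<close>, up to the
  boundary case. The intervals need only contain the point, not be centred at it, so that the
  one-sided intervals \<open>[x, x + h]\<close> and \<open>[x - h, x]\<close> are covered without any continuity argument.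
\<close>

definition steep_points :: "(real \<Rightarrow> real) \<Rightarrow> real \<Rightarrow> real set" where
  "steep_points \<phi> r =
     {x. \<forall>\<delta>>0. \<exists>z \<rho>. 0 < \<rho> \<and> \<rho> < \<delta> \<and> x \<in> cball z \<rho> \<and>
        2 * r * \<rho> < (LINT s:cball z \<rho>|lborel. \<phi> s)}"

text \<open>
  The hypothesis says that \<open>\<phi> - r\<close> has positive integral over the interval. Separating its
  positive and negative parts puts this into a form that can be summed over countably many disjoint
  intervals.
\<close>

lemma steep_interval_excess:
  fixes \<phi> :: "real \<Rightarrow> real"
  assumes \<phi>: "integrable lborel \<phi>" and "0 < \<rho>"
    and steep: "2 * r * \<rho> < (LINT s:cball z \<rho>|lborel. \<phi> s)"
  shows "(\<integral>\<^sup>+s. ennreal (indicator (cball z \<rho>) s * (r - \<phi> s)) \<partial>lborel)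
       \<le> (\<integral>\<^sup>+s. ennreal (indicator (cball z \<rho>) s * (\<phi> s - r)) \<partial>lborel)"
proof -
  let ?I = "cball z \<rho>"
  let ?h = "\<lambda>s. indicator ?I s * (\<phi> s - r)"
  have eq: "?I = {z - \<rho>..z + \<rho>}" by (auto simp: cball_def dist_real_def)
  have i1: "integrable lborel (\<lambda>s. indicator ?I s * \<phi> s)"
    using integrable_mult_indicator[of ?I lborel \<phi>] \<phi> by simp
  have i2: "integrable lborel (\<lambda>s. indicator ?I s * r)"
    unfolding eq by (intro integrable_mult_left impI integrable_real_indicator)
      (auto simp: emeasure_lborel_Icc_eq)
  have int: "integrable lborel ?h"
    using Bochner_Integration.integrable_diff[OF i1 i2] by (simp add: algebra_simps)
  have "integral\<^sup>L lborel ?h = (LINT s:?I|lborel. \<phi> s) - 2 * r * \<rho>"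
  proof -
    have "integral\<^sup>L lborel ?h = (LINT s|lborel. indicator ?I s * \<phi> s - indicator ?I s * r)"
      by (simp add: algebra_simps)
    also have "\<dots> = (LINT s:?I|lborel. \<phi> s) - (LINT s|lborel. indicator ?I s * r)"
      using i1 i2 by (simp add: set_lebesgue_integral_def)
    also have "(LINT s|lborel. indicator ?I s * r) = 2 * r * \<rho>"
      unfolding eq using \<open>0 < \<rho>\<close> by simp
    finally show ?thesis .
  qed
  then have pos: "0 < integral\<^sup>L lborel ?h" using steep by simp
  have "integral\<^sup>L lborel ?h = enn2real (\<integral>\<^sup>+s. ennreal (?h s) \<partial>lborel) - enn2real (\<integral>\<^sup>+s. ennreal (- ?h s) \<partial>lborel)"
    by (rule real_lebesgue_integral_def[OF int])
  with pos have le: "enn2real (\<integral>\<^sup>+s. ennreal (- ?h s) \<partial>lborel) \<le> enn2real (\<integral>\<^sup>+s. ennreal (?h s) \<partial>lborel)"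
    by simp
  have fin: "(\<integral>\<^sup>+s. ennreal (- ?h s) \<partial>lborel) < \<infinity>" "(\<integral>\<^sup>+s. ennreal (?h s) \<partial>lborel) < \<infinity>"
    using int real_integrable_def[of lborel ?h] by (auto simp: top.not_eq_extremum)
  have "(\<integral>\<^sup>+s. ennreal (- ?h s) \<partial>lborel) \<le> (\<integral>\<^sup>+s. ennreal (?h s) \<partial>lborel)"
    using ennreal_leI[OF le] fin by (simp only: ennreal_enn2real infinity_ennreal_def)
  moreover have "- ?h s = indicator ?I s * (r - \<phi> s)" for s
    by (simp add: algebra_simps)
  ultimately show ?thesis by simp
qed

text \<open>
  Let \<open>P\<close> and \<open>Q\<close> be the measures with densities the positive and the negative part of \<open>\<phi> - r\<close> on a bounded
  interval, and \<open>E\<close> the part of that interval where \<open>\<phi> < r\<close>. Then \<open>P E = 0\<close>, so by outer regularity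
  \<open>E\<close> has an open neighbourhood of small \<open>P\<close> measure. Vitali's theorem covers almost all steep
  points of \<open>E\<close> by disjoint steep intervals inside this neighbourhood, and on those \<open>Q \<le> P\<close>. So the
  steep points of \<open>E\<close> lie, up to a null set, in Borel sets of arbitrarily small \<open>Q\<close> measure. As \<open>Q\<close> has
  positive density on \<open>E\<close>, they form a null set. Passing to Borel
  supersets in this way avoids the question whether the set of steep points is measurable.
\<close>

lemma AE_steep_points:
  fixes \<phi> :: "real \<Rightarrow> real"
  assumes \<phi>: "integrable lborel \<phi>"
  shows "AE x in lborel. x \<in> steep_points \<phi> r \<and> \<bar>x\<bar> < N \<longrightarrow> r \<le> \<phi> x"
proof -
  have [measurable]: "\<phi> \<in> borel_measurable borel" using \<phi> by auto
  define B where "B = {-N<..<N}"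
  define P where "P = density lborel (\<lambda>x. ennreal (indicator B x * (\<phi> x - r)))"
  define Q where "Q = density lborel (\<lambda>x. ennreal (indicator B x * (r - \<phi> x)))"
  define E where "E = {x \<in> B. \<phi> x < r}"
  define S where "S = E \<inter> steep_points \<phi> r"
  have [measurable]: "B \<in> sets borel" "E \<in> sets borel" by (auto simp: B_def E_def)
  have sP: "sets P = sets borel" and sQ: "sets Q = sets borel" by (simp_all add: P_def Q_def)
  have emP: "emeasure P A = (\<integral>\<^sup>+s. ennreal (indicator B s * (\<phi> s - r)) * indicator A s \<partial>lborel)"
    and emQ: "emeasure Q A = (\<integral>\<^sup>+s. ennreal (indicator B s * (r - \<phi> s)) * indicator A s \<partial>lborel)"
    if "A \<in> sets borel" for A
    using that by (auto simp: P_def Q_def emeasure_density)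
  have finP: "emeasure P (space P) \<noteq> \<infinity>"
  proof -
    have "integrable lborel (\<lambda>s. indicator B s * \<phi> s - indicator B s * r)"
    proof (rule Bochner_Integration.integrable_diff)
      show "integrable lborel (\<lambda>s. indicator B s * \<phi> s)"
        using integrable_mult_indicator[of B lborel \<phi>] \<phi> by simp
      show "integrable lborel (\<lambda>s. indicator B s * r)"
        by (cases "-N \<le> N") (simp_all add: B_def)
    qed
    then have "integrable lborel (\<lambda>s. indicator B s * (\<phi> s - r))"
      by (simp add: algebra_simps)
    then have "(\<integral>\<^sup>+s. ennreal (indicator B s * (\<phi> s - r)) \<partial>lborel) \<noteq> \<infinity>"
      using real_integrable_def by blast
    then show ?thesis by (simp add: emP sP P_def emeasure_density)
  qed
  have PE: "emeasure P E = 0"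
    by (subst emP) (auto simp: nn_integral_0_iff_AE E_def indicator_def ennreal_neg intro!: AE_I2)
  \<comment> \<open>Small \<open>Q\<close> measure of \<open>U\<close> comes from the Vitali intervals, on which \<open>Q \<le> P\<close>.\<close>
  have cover: "\<exists>U\<in>sets borel. emeasure Q U \<le> ennreal \<epsilon> \<and> negligible (S - U)" if "0 < \<epsilon>" for \<epsilon>
  proof -
    have "(INF G \<in> {G. E \<subseteq> G \<and> open G}. emeasure P G) = 0"
      using outer_regular[OF sP finP, of E] PE by simp
    then have "(INF G \<in> {G. E \<subseteq> G \<and> open G}. emeasure P G) < ennreal \<epsilon>"
      using \<open>0 < \<epsilon>\<close> by simp
    then obtain G where G: "E \<subseteq> G" "open G" "emeasure P G < ennreal \<epsilon>"
      unfolding INF_less_iff by auto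
    have oGB: "open (G \<inter> B)" using G by (auto simp: B_def)
    \<comment> \<open>A pair encodes the closed interval with centre \<open>z\<close> and radius \<open>\<rho>\<close>.\<close>
    let ?K = "{(z, \<rho>). 0 < \<rho> \<and> cball z \<rho> \<subseteq> G \<inter> B \<and> 2 * r * \<rho> < (LINT s:cball z \<rho>|lborel. \<phi> s)}"
    obtain C where C: "countable C" "C \<subseteq> ?K"
      "pairwise (\<lambda>i j. disjnt (cball (fst i) (snd i)) (cball (fst j) (snd j))) C"
      "negligible (S - (\<Union>i\<in>C. cball (fst i) (snd i)))"
    proof (rule Vitali_covering_theorem_cballs[of ?K snd S fst])
      show "0 < snd i" if "i \<in> ?K" for i using that by auto
      show "\<exists>i. i \<in> ?K \<and> x \<in> cball (fst i) (snd i) \<and> snd i < d" if x: "x \<in> S" and "0 < d" for x d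
      proof -
        have "x \<in> G \<inter> B" using x G by (auto simp: S_def E_def)
        then obtain e where e: "0 < e" "ball x e \<subseteq> G \<inter> B"
          using oGB openE by blast
        have "0 < min d (e / 2)" using \<open>0 < d\<close> e by simp
        moreover have "x \<in> steep_points \<phi> r" using x by (simp add: S_def)
        ultimately obtain z \<rho> where z: "0 < \<rho>" "\<rho> < min d (e/2)" "x \<in> cball z \<rho>"
          "2 * r * \<rho> < (LINT s:cball z \<rho>|lborel. \<phi> s)"
          unfolding steep_points_def by blast
        have "cball z \<rho> \<subseteq> ball x e"
        proof
          fix y assume "y \<in> cball z \<rho>"
          then show "y \<in> ball x e" using z by (auto simp: dist_real_def)
        qed
        then have "(z, \<rho>) \<in> ?K" using e z by auto
        then show ?thesis using z by (intro exI[of _ "(z, \<rho>)"]) auto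
      qed
    qed
    let ?b = "\<lambda>i. cball (fst i) (snd i) :: real set"
    let ?U = "\<Union>i\<in>C. ?b i"
    have [measurable]: "?U \<in> sets borel"
      using C(1) by (intro sets.countable_UN') auto
    have disj: "disjoint_family_on ?b C"
      using C(3) by (auto simp: disjoint_family_on_def pairwise_def disjnt_def)
    have "emeasure Q (?b i) \<le> emeasure P (?b i)" if "i \<in> C" for i
    proof -
      have i: "0 < snd i" "?b i \<subseteq> B" "2 * r * snd i < (LINT s:?b i|lborel. \<phi> s)"
        using subsetD[OF C(2) that] by (auto simp: case_prod_beta)
      have "emeasure Q (?b i) = (\<integral>\<^sup>+s. ennreal (indicator (?b i) s * (r - \<phi> s)) \<partial>lborel)"
        using i(2) by (subst emQ) (auto intro!: nn_integral_cong simp: indicator_def)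
      also have "\<dots> \<le> (\<integral>\<^sup>+s. ennreal (indicator (?b i) s * (\<phi> s - r)) \<partial>lborel)"
        by (rule steep_interval_excess[OF \<phi> i(1) i(3)])
      also have "\<dots> = emeasure P (?b i)"
        using i(2) by (subst emP) (auto intro!: nn_integral_cong simp: indicator_def)
      finally show ?thesis .
    qed
    then have "emeasure Q ?U \<le> emeasure P ?U"
      using C(1) disj
      by (simp add: emeasure_UN_countable sP sQ) (auto intro!: nn_integral_mono)
    also have "\<dots> \<le> emeasure P G"
    proof (rule emeasure_mono)
      show "?U \<subseteq> G" using C(2) by (intro UN_least) (auto dest!: subsetD simp: case_prod_beta)
    qed (use G(2) in \<open>auto simp: sP\<close>)
    finally have "emeasure Q ?U \<le> ennreal \<epsilon>" using G(3) by simp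
    then show ?thesis using C(4) by (intro bexI[of _ ?U]) auto
  qed
  have "\<forall>n. \<exists>U\<in>sets borel. emeasure Q U \<le> ennreal (inverse (Suc n)) \<and> negligible (S - U)"
    using cover by (simp del: of_nat_Suc)
  then obtain U where U: "\<And>n. U n \<in> sets borel" "\<And>n. emeasure Q (U n) \<le> ennreal (inverse (Suc n))"
    "\<And>n. negligible (S - U n)"
    by metis
  define V where "V = (\<Inter>n. U n)"
  have V[measurable]: "V \<in> sets borel" unfolding V_def using U(1) by auto
  have "emeasure Q V = 0"
  proof -
    have "emeasure Q V \<le> ennreal (inverse (Suc n))" for n
    proof -
      have "emeasure Q V \<le> emeasure Q (U n)"
        using U(1) by (intro emeasure_mono) (auto simp: V_def sQ)
      then show ?thesis using U(2) order.trans by blast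
    qed
    moreover have "(\<lambda>n. ennreal (inverse (Suc n))) \<longlonglongrightarrow> ennreal 0"
      by (intro tendsto_ennrealI LIMSEQ_inverse_real_of_nat)
    ultimately have "emeasure Q V \<le> ennreal 0"
      by (intro LIMSEQ_le_const) auto
    then show ?thesis by simp
  qed
  then have "AE x in lborel. ennreal (indicator B x * (r - \<phi> x)) * indicator V x = 0"
    by (subst (asm) emQ) (auto simp: nn_integral_0_iff_AE)
  then have AEV: "AE x in lborel. x \<in> E \<longrightarrow> x \<notin> V"
    by eventually_elim (auto simp: E_def ennreal_eq_0_iff split: split_indicator_asm)
  have "negligible (\<Union>n. S - U n)"
    using U(3) by (intro negligible_Union_nat) auto
  moreover have "(\<Union>n. S - U n) = S - V" by (auto simp: V_def)
  ultimately have "S - V \<in> null_sets lebesgue" by (simp add: negligible_iff_null_sets)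
  then have "AE x in lebesgue. x \<notin> S - V" by (rule AE_not_in)
  moreover have "AE x in lebesgue. x \<in> E \<longrightarrow> x \<notin> V" by (rule AE_completion[OF AEV])
  ultimately have "AE x in lebesgue. x \<in> steep_points \<phi> r \<and> \<bar>x\<bar> < N \<longrightarrow> r \<le> \<phi> x"
    by eventually_elim (auto simp: S_def E_def B_def)
  then show ?thesis by (simp add: AE_completion_iff)
qed

text \<open>
  Almost everywhere, no rational \<open>r > \<phi> x\<close> is exceeded by the means of \<open>\<phi>\<close> over arbitrarily short
  intervals around \<open>x\<close>, and no rational \<open>r < \<phi> x\<close> exceeds them; the latter is the former for
  \<open>- \<phi>\<close>. This pins the difference quotients to \<open>\<phi> x\<close>.
\<close>

theorem lebesgue_differentiation:
  fixes \<phi> :: "real \<Rightarrow> real"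
  assumes \<phi>: "integrable lborel \<phi>"
  shows "AE x in lborel. ((\<lambda>t. LINT s:{..t}|lborel. \<phi> s) has_real_derivative \<phi> x) (at x)"
proof -
  define F where "F t = (LINT s:{..t}|lborel. \<phi> s)" for t
  have steep: "AE x in lborel. \<forall>r\<in>\<rat>. x \<in> steep_points \<phi> r \<longrightarrow> r \<le> \<phi> x"
    if "integrable lborel \<phi>" for \<phi> :: "real \<Rightarrow> real"
  proof (intro AE_ball_countable' countable_rat)
    fix r :: real
    have "AE x in lborel. \<forall>N::nat. x \<in> steep_points \<phi> r \<and> \<bar>x\<bar> < real N \<longrightarrow> r \<le> \<phi> x"
      using AE_steep_points[OF that] by (subst AE_all_countable) blast
    then show "AE x in lborel. x \<in> steep_points \<phi> r \<longrightarrow> r \<le> \<phi> x"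
      by eventually_elim (use reals_Archimedean2 in blast)
  qed
  have "AE x in lborel. \<forall>r\<in>\<rat>. x \<in> steep_points (\<lambda>s. - \<phi> s) r \<longrightarrow> r \<le> - \<phi> x"
    using \<phi> by (intro steep) auto
  moreover note steep[OF \<phi>]
  ultimately have "AE x in lborel. (F has_real_derivative \<phi> x) (at x)"
  proof eventually_elim
    fix x
    assume A: "\<forall>r\<in>\<rat>. x \<in> steep_points (\<lambda>s. - \<phi> s) r \<longrightarrow> r \<le> - \<phi> x"
      and B: "\<forall>r\<in>\<rat>. x \<in> steep_points \<phi> r \<longrightarrow> r \<le> \<phi> x"
    \<comment> \<open>The left end point belongs to the closed interval but not to the difference; it is a null set.\<close>
    have F_diff: "(LINT s:cball z \<rho>|lborel. \<psi> s) = (LINT s:{..z+\<rho>}|lborel. \<psi> s) - (LINT s:{..z-\<rho>}|lborel. \<psi> s)"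
      if \<psi>: "integrable lborel \<psi>" and "0 < \<rho>" for z \<rho> and \<psi> :: "real \<Rightarrow> real"
    proof -
      have [measurable]: "\<psi> \<in> borel_measurable borel" "cball z \<rho> \<in> sets borel"
        using \<psi> by auto
      have si: "set_integrable lborel A \<psi>" if "A \<in> sets borel" for A
        unfolding set_integrable_def using that \<psi> by (intro integrable_mult_indicator) auto
      have "(LINT s:cball z \<rho>|lborel. \<psi> s) = (LINT s:{z-\<rho><..z+\<rho>}|lborel. \<psi> s)"
        unfolding set_lebesgue_integral_def
      proof (rule integral_cong_AE)
        show "AE s in lborel. indicat_real (cball z \<rho>) s *\<^sub>R \<psi> s = indicat_real {z-\<rho><..z+\<rho>} s *\<^sub>R \<psi> s"
          using AE_lborel_singleton[of "z - \<rho>"]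
          by eventually_elim (auto simp: indicator_def dist_real_def)
      qed auto
      moreover have "(LINT s:{..z+\<rho>}|lborel. \<psi> s) = (LINT s:{..z-\<rho>}|lborel. \<psi> s) + (LINT s:{z-\<rho><..z+\<rho>}|lborel. \<psi> s)"
      proof -
        have "{..z+\<rho>} = {..z-\<rho>} \<union> {z-\<rho><..z+\<rho>}" using \<open>0 < \<rho>\<close> by auto
        moreover have "{..z-\<rho>} \<inter> {z-\<rho><..z+\<rho>} = {}" by auto
        ultimately show ?thesis using set_integral_Un[of "{..z-\<rho>}" "{z-\<rho><..z+\<rho>}" lborel \<psi>] si by simp
      qed
      ultimately show ?thesis by simp
    qed
    have bound: "\<exists>\<delta>>0. \<forall>h. h \<noteq> 0 \<and> \<bar>h\<bar> < \<delta> \<longrightarrow>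
        ((LINT s:{..x+h}|lborel. \<psi> s) - (LINT s:{..x}|lborel. \<psi> s)) / h \<le> r"
      if \<psi>: "integrable lborel \<psi>" and st: "x \<notin> steep_points \<psi> r" for \<psi> :: "real \<Rightarrow> real" and r
    proof -
      obtain \<delta> where "0 < \<delta>" and "\<not> (\<exists>z \<rho>. 0 < \<rho> \<and> \<rho> < \<delta> \<and> x \<in> cball z \<rho> \<and>
          2 * r * \<rho> < (LINT s:cball z \<rho>|lborel. \<psi> s))"
        using st unfolding steep_points_def by blast
      then have \<delta>: "0 < \<delta>"
        "\<And>z \<rho>. 0 < \<rho> \<Longrightarrow> \<rho> < \<delta> \<Longrightarrow> x \<in> cball z \<rho> \<Longrightarrow> (LINT s:cball z \<rho>|lborel. \<psi> s) \<le> 2 * r * \<rho>"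
        by (auto simp: not_less simp del: mem_cball) (meson not_less)
      show ?thesis
      proof (intro exI[of _ \<delta>] conjI allI impI)
        fix h :: real assume h: "h \<noteq> 0 \<and> \<bar>h\<bar> < \<delta>"
        have "(LINT s:cball (x+h/2) (\<bar>h\<bar>/2)|lborel. \<psi> s) \<le> 2 * r * (\<bar>h\<bar>/2)"
          using h by (intro \<delta>(2)) (auto simp: dist_real_def)
        then have le: "(LINT s:{..x+h/2+\<bar>h\<bar>/2}|lborel. \<psi> s) - (LINT s:{..x+h/2-\<bar>h\<bar>/2}|lborel. \<psi> s) \<le> r * \<bar>h\<bar>"
          using h by (subst (asm) F_diff[OF \<psi>]) auto
        show "((LINT s:{..x+h}|lborel. \<psi> s) - (LINT s:{..x}|lborel. \<psi> s)) / h \<le> r"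
        proof (cases "0 < h")
          case True
          then have "x + h/2 + \<bar>h\<bar>/2 = x + h" "x + h/2 - \<bar>h\<bar>/2 = x" by auto
          with le True show ?thesis by (simp only: pos_divide_le_eq abs_of_pos)
        next
          case False
          then have "x + h/2 + \<bar>h\<bar>/2 = x" "x + h/2 - \<bar>h\<bar>/2 = x + h" "h < 0" using h by auto
          with le show ?thesis by (simp add: neg_divide_le_eq add.commute)
        qed
      qed (use \<delta> in auto)
    qed
    have up: "\<exists>\<delta>>0. \<forall>h. h \<noteq> 0 \<and> \<bar>h\<bar> < \<delta> \<longrightarrow> (F (x+h) - F x) / h \<le> \<phi> x + \<epsilon>" if "0 < \<epsilon>" for \<epsilon>
    proof -
      obtain r where r: "r \<in> \<rat>" "\<phi> x < r" "r < \<phi> x + \<epsilon>"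
        using Rats_dense_in_real[of "\<phi> x" "\<phi> x + \<epsilon>"] \<open>0 < \<epsilon>\<close> by (metis less_add_same_cancel1)
      then have "x \<notin> steep_points \<phi> r" using B by auto
      from bound[OF \<phi> this] obtain \<delta> where
        "0 < \<delta>" "\<And>h. h \<noteq> 0 \<and> \<bar>h\<bar> < \<delta> \<Longrightarrow> (F (x+h) - F x) / h \<le> r"
        unfolding F_def by auto
      with r(3) show ?thesis by (intro exI[of _ \<delta>]) force
    qed
    have lo: "\<exists>\<delta>>0. \<forall>h. h \<noteq> 0 \<and> \<bar>h\<bar> < \<delta> \<longrightarrow> (F (x+h) - F x) / h \<ge> \<phi> x - \<epsilon>" if "0 < \<epsilon>" for \<epsilon>
    proof -
      obtain r where r: "r \<in> \<rat>" "- \<phi> x < r" "r < - \<phi> x + \<epsilon>"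
        using Rats_dense_in_real[of "- \<phi> x" "- \<phi> x + \<epsilon>"] \<open>0 < \<epsilon>\<close> by (metis less_add_same_cancel1)
      then have "x \<notin> steep_points (\<lambda>s. - \<phi> s) r" using A by auto
      moreover have "integrable lborel (\<lambda>s. - \<phi> s)" using \<phi> by simp
      ultimately obtain \<delta> where \<delta>:
        "0 < \<delta>" "\<And>h. h \<noteq> 0 \<and> \<bar>h\<bar> < \<delta> \<Longrightarrow>
           ((LINT s:{..x+h}|lborel. - \<phi> s) - (LINT s:{..x}|lborel. - \<phi> s)) / h \<le> r"
        using bound by blast
      have "(F (x+h) - F x) / h \<ge> \<phi> x - \<epsilon>" if "h \<noteq> 0 \<and> \<bar>h\<bar> < \<delta>" for h
      proof -
        have "((LINT s:{..x+h}|lborel. - \<phi> s) - (LINT s:{..x}|lborel. - \<phi> s)) / h = - ((F (x+h) - F x) / h)"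
          unfolding F_def set_lebesgue_integral_def by (simp add: diff_divide_distrib)
        then show ?thesis using \<delta>(2)[OF that] r(3) by linarith
      qed
      then show ?thesis using \<delta>(1) by blast
    qed
    show "(F has_real_derivative \<phi> x) (at x)"
      unfolding DERIV_def
    proof (rule LIM_I)
      fix e :: real assume "0 < e"
      then have e: "0 < e / 2" by simp
      obtain \<delta>1 where 1: "0 < \<delta>1" "\<And>h. h \<noteq> 0 \<and> \<bar>h\<bar> < \<delta>1 \<Longrightarrow> (F (x+h) - F x) / h \<le> \<phi> x + e/2"
        using up[OF e] by blast
      obtain \<delta>2 where 2: "0 < \<delta>2" "\<And>h. h \<noteq> 0 \<and> \<bar>h\<bar> < \<delta>2 \<Longrightarrow> (F (x+h) - F x) / h \<ge> \<phi> x - e/2"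
        using lo[OF e] by blast
      show "\<exists>s>0. \<forall>h. h \<noteq> 0 \<and> norm (h - 0) < s \<longrightarrow> norm ((F (x + h) - F x) / h - \<phi> x) < e"
      proof (intro exI[of _ "min \<delta>1 \<delta>2"] conjI allI impI)
        fix h :: real assume h: "h \<noteq> 0 \<and> norm (h - 0) < min \<delta>1 \<delta>2"
        then show "norm ((F (x + h) - F x) / h - \<phi> x) < e"
          using 1(2)[of h] 2(2)[of h] \<open>0 < e\<close> by (auto simp: abs_less_iff)
      qed (use 1 2 in auto)
    qed
  qed
  then show ?thesis unfolding F_def .
qed

section \<open>Riemann--Liouville kernels and convolution\<close>

definition rl_kernel :: "real \<Rightarrow> real \<Rightarrow> real" where
  "rl_kernel \<beta> t = (if 0 < t then t powr (\<beta> - 1) / Gamma \<beta> else 0)"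

definition conv :: "(real \<Rightarrow> real) \<Rightarrow> (real \<Rightarrow> real) \<Rightarrow> real \<Rightarrow> real" where
  "conv f g x = (LINT s|lborel. f (x - s) * g s)"

lemma rl_kernel_measurable [measurable]: "rl_kernel \<beta> \<in> borel_measurable borel"
  unfolding rl_kernel_def by measurable

lemma conv_measurable [measurable]:
  assumes [measurable]: "f \<in> borel_measurable borel" "g \<in> borel_measurable borel"
  shows "conv f g \<in> borel_measurable borel"
  unfolding conv_def by measurable

lemma rl_kernel_nonneg: "0 < \<beta> \<Longrightarrow> 0 \<le> rl_kernel \<beta> t"
  by (simp add: rl_kernel_def Gamma_real_nonneg)

lemma rl_kernel_mono:
  assumes "1 \<le> \<beta>" "t \<le> L"
  shows "rl_kernel \<beta> t \<le> rl_kernel \<beta> L"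
  using assms by (auto simp: rl_kernel_def Gamma_real_nonneg intro!: divide_right_mono powr_mono2)

lemma rl_kernel_Suc: "0 < t \<Longrightarrow> rl_kernel (real (Suc n)) t = t ^ n / fact n"
  by (simp add: rl_kernel_def powr_realpow Gamma_fact[of n, symmetric] add.commute)

lemma rl_kernel_nonpos: "rl_kernel \<beta> t = 0" if "t \<le> 0"
  using that by (simp add: rl_kernel_def)

text \<open>
  The substitution \<open>r = t w\<close> turns the integral into a Beta integral. The version for nonnegative
  integrals comes first since it also supplies integrability.
\<close>

lemma nn_conv_rl_kernel:
  assumes "0 < \<alpha>" "0 < \<beta>"
  shows "(\<integral>\<^sup>+r. ennreal (rl_kernel \<alpha> (t - r) * rl_kernel \<beta> r) \<partial>lborel) = ennreal (rl_kernel (\<alpha> + \<beta>) t)"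
proof (cases "0 < t")
  case False
  then have z: "rl_kernel \<alpha> (t - r) * rl_kernel \<beta> r = 0" for r
    by (cases "r \<le> 0") (simp_all add: rl_kernel_nonpos)
  have "(\<integral>\<^sup>+r. ennreal (rl_kernel \<alpha> (t - r) * rl_kernel \<beta> r) \<partial>lborel) = (\<integral>\<^sup>+r. 0 \<partial>(lborel :: real measure))"
    by (intro nn_integral_cong) (simp only: z ennreal_0)
  then show ?thesis using False by (simp add: rl_kernel_nonpos)
next
  case True
  let ?C = "t powr (\<alpha> + \<beta> - 2) / (Gamma \<alpha> * Gamma \<beta>)"
  let ?g = "\<lambda>w. w powr (\<beta> - 1) * (1 - w) powr (\<alpha> - 1)"
  have G: "0 < Gamma \<alpha>" "0 < Gamma \<beta>" "0 < Gamma (\<alpha> + \<beta>)" using assms by (auto intro!: Gamma_real_pos)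
  have pt: "rl_kernel \<alpha> (t - t * w) * rl_kernel \<beta> (t * w) = ?C * (indicator {0..1} w * ?g w)" for w
  proof (cases "0 < w \<and> w < 1")
    case True
    have w: "t - t * w = t * (1 - w)" by (simp add: algebra_simps)
    have k1: "rl_kernel \<alpha> (t - t * w) = t powr (\<alpha> - 1) * (1 - w) powr (\<alpha> - 1) / Gamma \<alpha>"
      unfolding w using True \<open>0 < t\<close> by (simp add: rl_kernel_def powr_mult)
    have k2: "rl_kernel \<beta> (t * w) = t powr (\<beta> - 1) * w powr (\<beta> - 1) / Gamma \<beta>"
      using True \<open>0 < t\<close> by (simp add: rl_kernel_def powr_mult)
    have e: "t powr (\<alpha> + \<beta> - 2) = t powr (\<alpha> - 1) * t powr (\<beta> - 1)"
      by (simp flip: powr_add)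
    have "indicator {0..1} w = (1::real)" using True by simp
    then show ?thesis unfolding k1 k2 e by simp
  next
    case False
    then consider "w < 0" | "w = 0" | "w = 1" | "1 < w" by linarith
    then show ?thesis using \<open>0 < t\<close> by cases (auto simp: rl_kernel_def zero_less_mult_iff)
  qed
  have B: "(\<integral>\<^sup>+w. indicator {0..1} w * ?g w \<partial>lborel) = Beta \<beta> \<alpha>"
    by (rule nn_integral_has_integral_lebesgue[OF _ has_integral_Beta_real]) (use assms in auto)
  have "(\<integral>\<^sup>+r. ennreal (rl_kernel \<alpha> (t - r) * rl_kernel \<beta> r) \<partial>lborel)
      = \<bar>t\<bar> * (\<integral>\<^sup>+w. ennreal (rl_kernel \<alpha> (t - t * w) * rl_kernel \<beta> (t * w)) \<partial>lborel)"
    using True by (subst nn_integral_real_affine[where c = t and t = 0]) auto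
  also have "\<dots> = ennreal t * (\<integral>\<^sup>+w. ennreal ?C * ennreal (indicator {0..1} w * ?g w) \<partial>lborel)"
  proof -
    have "ennreal (?C * y) = ennreal ?C * ennreal y" for y
      using G by (intro ennreal_mult') simp
    then show ?thesis unfolding pt using True by (simp only: abs_of_pos)
  qed
  also have "\<dots> = ennreal t * (ennreal ?C * ennreal (Beta \<beta> \<alpha>))"
    using B by (subst nn_integral_cmult) auto
  also have "\<dots> = ennreal (t * ?C * Beta \<beta> \<alpha>)"
  proof -
    have "0 \<le> Beta \<beta> \<alpha>" using G by (simp add: Beta_def add.commute)
    then show ?thesis using True G by (simp flip: ennreal_mult add: mult.assoc)
  qed
  also have "t * ?C * Beta \<beta> \<alpha> = rl_kernel (\<alpha> + \<beta>) t"
  proof -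
    have "t * t powr (\<alpha> + \<beta> - 2) = t powr (\<alpha> + \<beta> - 1)"
      using True powr_mult_base[of t "\<alpha> + \<beta> - 2"] by simp
    moreover have "Beta \<beta> \<alpha> = Gamma \<alpha> * Gamma \<beta> / Gamma (\<alpha> + \<beta>)"
      by (simp add: Beta_def add.commute)
    ultimately show ?thesis using True G by (simp add: rl_kernel_def)
  qed
  finally show ?thesis .
qed

lemma conv_rl_kernel:
  assumes "0 < \<alpha>" "0 < \<beta>"
  shows "integrable lborel (\<lambda>r. rl_kernel \<alpha> (t - r) * rl_kernel \<beta> r)"
    and "conv (rl_kernel \<alpha>) (rl_kernel \<beta>) t = rl_kernel (\<alpha> + \<beta>) t"
proof -
  have "integrable lborel (\<lambda>r. rl_kernel \<alpha> (t - r) * rl_kernel \<beta> r) \<and>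
    (LINT r|lborel. rl_kernel \<alpha> (t - r) * rl_kernel \<beta> r) = rl_kernel (\<alpha> + \<beta>) t"
  proof (subst nn_integral_eq_integrable[symmetric])
    show "AE r in lborel. 0 \<le> rl_kernel \<alpha> (t - r) * rl_kernel \<beta> r"
      using assms by (intro AE_I2 mult_nonneg_nonneg rl_kernel_nonneg)
    show "0 \<le> rl_kernel (\<alpha> + \<beta>) t" using assms by (intro rl_kernel_nonneg) simp
    show "(\<integral>\<^sup>+r. ennreal (rl_kernel \<alpha> (t - r) * rl_kernel \<beta> r) \<partial>lborel) = ennreal (rl_kernel (\<alpha> + \<beta>) t)"
      by (rule nn_conv_rl_kernel[OF assms])
  qed measurable
  then show "integrable lborel (\<lambda>r. rl_kernel \<alpha> (t - r) * rl_kernel \<beta> r)"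
    "conv (rl_kernel \<alpha>) (rl_kernel \<beta>) t = rl_kernel (\<alpha> + \<beta>) t"
    by (auto simp: conv_def)
qed

text \<open>
  This is Fubini's theorem. A uniform bound on the absolute convolution of the two kernels makes the
  identity valid at every point \<open>x\<close> rather than almost everywhere; this matters because the result is
  going to be differentiated classically.
\<close>

lemma conv_assoc:
  fixes F G H :: "real \<Rightarrow> real"
  assumes [measurable]: "F \<in> borel_measurable borel" "G \<in> borel_measurable borel"
    and H: "integrable lborel H" and H0: "\<And>s. s < a \<Longrightarrow> H s = 0"
    and bound: "\<And>t. t \<le> x - a \<Longrightarrow> (\<integral>\<^sup>+r. ennreal \<bar>F (t - r) * G r\<bar> \<partial>lborel) \<le> ennreal B"
  shows "integrable lborel (\<lambda>s. conv F G (x - s) * H s)"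
    and "integrable lborel (\<lambda>y. F (x - y) * conv G H y)"
    and "conv F (conv G H) x = conv (conv F G) H x"
proof -
  have [measurable]: "H \<in> borel_measurable borel" using H by auto
  define f where "f s y = F (x - y) * G (y - s) * H s" for s y
  have [measurable]: "case_prod f \<in> borel_measurable (lborel \<Otimes>\<^sub>M lborel)"
    unfolding f_def by measurable
  have int: "integrable (lborel \<Otimes>\<^sub>M lborel) (case_prod f)"
  proof (rule integrableI_bounded)
    have "(\<integral>\<^sup>+z. ennreal (norm (case_prod f z)) \<partial>(lborel \<Otimes>\<^sub>M lborel))
        = (\<integral>\<^sup>+s. (\<integral>\<^sup>+y. ennreal \<bar>f s y\<bar> \<partial>lborel) \<partial>lborel)"
      by (subst lborel.nn_integral_fst[symmetric]) auto
    also have "\<dots> \<le> (\<integral>\<^sup>+s. ennreal B * ennreal \<bar>H s\<bar> \<partial>lborel)"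
    proof (rule nn_integral_mono)
      fix s
      show "(\<integral>\<^sup>+y. ennreal \<bar>f s y\<bar> \<partial>lborel) \<le> ennreal B * ennreal \<bar>H s\<bar>"
      proof (cases "s < a")
        case True then show ?thesis by (simp add: f_def H0)
      next
        case False
        have "(\<integral>\<^sup>+y. ennreal \<bar>f s y\<bar> \<partial>lborel) = (\<integral>\<^sup>+r. ennreal \<bar>f s (s + 1 * r)\<bar> \<partial>lborel)"
          by (subst nn_integral_real_affine[where c = 1 and t = s]) (auto simp: f_def)
        also have "\<dots> = (\<integral>\<^sup>+r. ennreal \<bar>F ((x - s) - r) * G r\<bar> * ennreal \<bar>H s\<bar> \<partial>lborel)"
          by (auto simp: f_def abs_mult ennreal_mult algebra_simps intro!: nn_integral_cong)
        also have "\<dots> = (\<integral>\<^sup>+r. ennreal \<bar>F ((x - s) - r) * G r\<bar> \<partial>lborel) * ennreal \<bar>H s\<bar>"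
          by (rule nn_integral_multc) auto
        also have "\<dots> \<le> ennreal B * ennreal \<bar>H s\<bar>"
          using bound[of "x - s"] False by (intro mult_right_mono) auto
        finally show ?thesis .
      qed
    qed
    also have "\<dots> = ennreal B * (\<integral>\<^sup>+s. ennreal \<bar>H s\<bar> \<partial>lborel)"
      by (rule nn_integral_cmult) auto
    also have "\<dots> < \<infinity>"
      using H by (auto simp: integrable_iff_bounded ennreal_mult_less_top)
    finally show "(\<integral>\<^sup>+z. ennreal (norm (case_prod f z)) \<partial>(lborel \<Otimes>\<^sub>M lborel)) < \<infinity>" .
  qed auto
  have inner1: "(LINT y|lborel. f s y) = conv F G (x - s) * H s" for s
  proof -
    have "(LINT y|lborel. f s y) = (LINT y|lborel. F (x - y) * G (y - s)) * H s"
      by (simp add: f_def)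
    also have "(LINT y|lborel. F (x - y) * G (y - s)) = (LINT r|lborel. F (x - (s + 1 * r)) * G ((s + 1 * r) - s))"
      by (subst lborel_integral_real_affine[where c = 1 and t = s]) auto
    also have "\<dots> = conv F G (x - s)" by (simp add: conv_def algebra_simps)
    finally show ?thesis .
  qed
  have inner2: "(LINT s|lborel. f s y) = F (x - y) * conv G H y" for y
    by (simp add: f_def conv_def mult.assoc)
  show "integrable lborel (\<lambda>s. conv F G (x - s) * H s)"
    using lborel_pair.integrable_fst'[OF int] by (simp add: inner1)
  show "integrable lborel (\<lambda>y. F (x - y) * conv G H y)"
    using lborel_pair.integrable_snd[OF int] by (simp add: inner2)
  show "conv F (conv G H) x = conv (conv F G) H x"
    using lborel_pair.Fubini_integral[OF int] unfolding inner1 inner2 by (simp add: conv_def)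
qed

section \<open>The correction kernel for exponential weights\<close>

text \<open>
  The coefficients \<open>c\<^sub>j\<close> are chosen so that \<open>c\<^sub>j K\<^sub>\<alpha>\<^sub>+\<^sub>j\<^sub>+\<^sub>1 t = K\<^sub>\<alpha> t (\<sigma> t)\<^sup>j\<^sup>+\<^sup>1 / (j + 1)!\<close>, the terms of
  \<open>(exp (\<sigma> t) - 1) K\<^sub>\<alpha> t\<close>.
\<close>

definition temper_coeff :: "real \<Rightarrow> real \<Rightarrow> nat \<Rightarrow> real" where
  "temper_coeff \<alpha> \<sigma> j = \<sigma> ^ Suc j * Gamma (\<alpha> + real (Suc j)) / (fact (Suc j) * Gamma \<alpha>)"

text \<open>
  On \<open>t > 0\<close> this is the confluent hypergeometric function \<open>\<sigma> \<alpha> F(\<alpha> + 1; 2; \<sigma> t)\<close>.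
\<close>

definition temper_kernel :: "real \<Rightarrow> real \<Rightarrow> real \<Rightarrow> real" where
  "temper_kernel \<alpha> \<sigma> t = (\<Sum>j. temper_coeff \<alpha> \<sigma> j * rl_kernel (real (Suc j)) t)"

definition temper_bound :: "real \<Rightarrow> real \<Rightarrow> real \<Rightarrow> real" where
  "temper_bound \<alpha> \<sigma> L = (\<Sum>j. \<bar>temper_coeff \<alpha> \<sigma> j\<bar> * rl_kernel (real (Suc j)) L)"

lemma temper_kernel_measurable [measurable]: "temper_kernel \<alpha> \<sigma> \<in> borel_measurable borel"
  unfolding temper_kernel_def by measurable

lemma summable_temper_coeff:
  assumes "0 < \<alpha>"
  shows "summable (\<lambda>j. \<bar>temper_coeff \<alpha> \<sigma> j\<bar> * rl_kernel (real (Suc j)) t)"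
proof (cases "0 < t")
  case False
  then show ?thesis by (simp add: rl_kernel_nonpos del: of_nat_Suc)
next
  case True
  let ?f = "\<lambda>j. \<bar>temper_coeff \<alpha> \<sigma> j\<bar> * (t ^ j / fact j)"
  \<comment> \<open>Beyond \<open>N\<close> the ratio of consecutive terms is at most \<open>1 / 2\<close>.\<close>
  obtain N :: nat where N: "2 * (\<bar>\<sigma>\<bar> * (\<alpha> + 1) * t) < real N"
    using reals_Archimedean2 by blast
  have "summable ?f"
  proof (rule summable_ratio_test[of "1/2"])
    fix n assume "N \<le> n"
    have G: "0 < Gamma \<alpha>" "0 < Gamma (\<alpha> + real (Suc n))" using assms by (auto intro!: Gamma_real_pos)
    have "Gamma (\<alpha> + real (Suc (Suc n))) = (\<alpha> + real (Suc n)) * Gamma (\<alpha> + real (Suc n))"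
    proof -
      have "\<alpha> + real (Suc n) \<notin> \<int>\<^sub>\<le>\<^sub>0" using assms by (auto dest: nonpos_Ints_nonpos)
      then show ?thesis using Gamma_plus1[of "\<alpha> + real (Suc n)"] by (simp add: add_ac)
    qed
    then have "temper_coeff \<alpha> \<sigma> (Suc n) = temper_coeff \<alpha> \<sigma> n * (\<sigma> * ((\<alpha> + real (Suc n)) / real (Suc (Suc n))))"
      unfolding temper_coeff_def fact_Suc[of "Suc n"] power_Suc[of \<sigma> "Suc n"]
      by (simp add: mult_ac del: of_nat_Suc fact_Suc power_Suc)
    then have "\<bar>temper_coeff \<alpha> \<sigma> (Suc n)\<bar> = \<bar>temper_coeff \<alpha> \<sigma> n\<bar> * (\<bar>\<sigma>\<bar> * ((\<alpha> + real (Suc n)) / real (Suc (Suc n))))"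
      using assms by (simp only: abs_mult abs_divide abs_of_nonneg of_nat_0_le_iff add_nonneg_nonneg less_imp_le)
    moreover have "t ^ Suc n / fact (Suc n) = t ^ n / fact n * (t / real (Suc n))"
      by (simp add: mult.commute del: of_nat_Suc)
    moreover have "C * (S * Q) * (T * (r / m)) = C * T * (S * Q * r / m)" for C S Q T r m :: real
      by simp
    ultimately have step: "?f (Suc n) = ?f n * (\<bar>\<sigma>\<bar> * ((\<alpha> + real (Suc n)) / real (Suc (Suc n))) * t / real (Suc n))"
      by (simp only:)
    have "(\<alpha> + real (Suc n)) / real (Suc (Suc n)) \<le> \<alpha> + 1"
      using assms by (simp add: divide_simps algebra_simps)
    then have "\<bar>\<sigma>\<bar> * ((\<alpha> + real (Suc n)) / real (Suc (Suc n))) * t \<le> \<bar>\<sigma>\<bar> * (\<alpha> + 1) * t"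
      using True by (intro mult_right_mono mult_left_mono) auto
    also have "\<dots> \<le> 1 / 2 * real (Suc n)" using N \<open>N \<le> n\<close> by simp
    finally have "\<bar>\<sigma>\<bar> * ((\<alpha> + real (Suc n)) / real (Suc (Suc n))) * t / real (Suc n) \<le> 1 / 2"
      by (simp only: pos_divide_le_eq of_nat_0_less_iff zero_less_Suc)
    moreover have "0 \<le> ?f n" using True by simp
    ultimately have le: "?f (Suc n) \<le> ?f n * (1 / 2)"
      unfolding step by (intro mult_left_mono)
    have nf: "norm (?f k) = ?f k" for k using True by simp
    show "norm (?f (Suc n)) \<le> 1 / 2 * norm (?f n)"
      unfolding nf using le by (simp only: mult.commute)
  qed simp
  then show ?thesis using True by (simp add: rl_kernel_Suc del: of_nat_Suc)
qed

lemma temper_kernel_nonpos: "t \<le> 0 \<Longrightarrow> temper_kernel \<alpha> \<sigma> t = 0"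
  by (simp add: temper_kernel_def rl_kernel_nonpos del: of_nat_Suc)

lemma temper_bound_nonneg: "0 < \<alpha> \<Longrightarrow> 0 \<le> temper_bound \<alpha> \<sigma> L"
  unfolding temper_bound_def
  by (intro suminf_nonneg summable_temper_coeff mult_nonneg_nonneg rl_kernel_nonneg) auto

lemma abs_temper_kernel_le:
  assumes "0 < \<alpha>" "t \<le> L"
  shows "\<bar>temper_kernel \<alpha> \<sigma> t\<bar> \<le> temper_bound \<alpha> \<sigma> L"
proof -
  have n: "norm (temper_coeff \<alpha> \<sigma> j * rl_kernel (real (Suc j)) t) = \<bar>temper_coeff \<alpha> \<sigma> j\<bar> * rl_kernel (real (Suc j)) t" for j
    using rl_kernel_nonneg[of "real (Suc j)" t] by (simp add: abs_mult)
  have "norm (temper_kernel \<alpha> \<sigma> t) \<le> (\<Sum>j. \<bar>temper_coeff \<alpha> \<sigma> j\<bar> * rl_kernel (real (Suc j)) t)"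
    unfolding temper_kernel_def using summable_temper_coeff[OF assms(1), of \<sigma> t]
    by (subst n[symmetric], intro summable_norm) (simp only: n)
  also have "\<dots> \<le> temper_bound \<alpha> \<sigma> L"
    unfolding temper_bound_def using assms
    by (intro suminf_le summable_temper_coeff mult_left_mono rl_kernel_mono) auto
  finally show ?thesis by simp
qed

text \<open>
  This is the bound that \<open>conv_assoc\<close> requires. The kernel \<open>K\<^sub>1\<close> is the indicator of \<open>t > 0\<close>, so the
  boundedness of the correction kernel reduces the claim to \<open>K\<^sub>\<alpha> \<star> K\<^sub>1 = K\<^sub>\<alpha>\<^sub>+\<^sub>1\<close>, which is increasing.
\<close>

lemma nn_conv_temper_kernel_le:
  assumes "0 < \<alpha>" "t \<le> L"
  shows "(\<integral>\<^sup>+r. ennreal \<bar>rl_kernel \<alpha> (t - r) * temper_kernel \<alpha> \<sigma> r\<bar> \<partial>lborel)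
       \<le> ennreal (temper_bound \<alpha> \<sigma> L * rl_kernel (\<alpha> + 1) L)"
proof -
  let ?M = "temper_bound \<alpha> \<sigma> L"
  have M: "0 \<le> ?M" using assms by (simp add: temper_bound_nonneg)
  have pt: "\<bar>rl_kernel \<alpha> (t - r) * temper_kernel \<alpha> \<sigma> r\<bar> \<le> ?M * (rl_kernel \<alpha> (t - r) * rl_kernel 1 r)" for r
  proof (cases "0 < r \<and> r < t")
    case True
    have "rl_kernel \<alpha> (t - r) * \<bar>temper_kernel \<alpha> \<sigma> r\<bar> \<le> rl_kernel \<alpha> (t - r) * ?M"
      using assms True by (intro mult_left_mono abs_temper_kernel_le rl_kernel_nonneg) auto
    moreover have "rl_kernel 1 r = 1" using True by (simp add: rl_kernel_def)
    ultimately show ?thesis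
      using rl_kernel_nonneg[OF assms(1), of "t - r"] by (simp add: abs_mult mult.commute)
  next
    case False
    then have "rl_kernel \<alpha> (t - r) * temper_kernel \<alpha> \<sigma> r = 0"
      by (cases "r \<le> 0") (auto simp: temper_kernel_nonpos rl_kernel_nonpos)
    then have "\<bar>rl_kernel \<alpha> (t - r) * temper_kernel \<alpha> \<sigma> r\<bar> = 0" by (simp only: abs_zero)
    moreover have "0 \<le> ?M * (rl_kernel \<alpha> (t - r) * rl_kernel 1 r)"
      using M assms by (intro mult_nonneg_nonneg rl_kernel_nonneg) auto
    ultimately show ?thesis by linarith
  qed
  have "(\<integral>\<^sup>+r. ennreal \<bar>rl_kernel \<alpha> (t - r) * temper_kernel \<alpha> \<sigma> r\<bar> \<partial>lborel)
      \<le> (\<integral>\<^sup>+r. ennreal ?M * ennreal (rl_kernel \<alpha> (t - r) * rl_kernel 1 r) \<partial>lborel)"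
    using pt M by (intro nn_integral_mono) (auto simp flip: ennreal_mult' intro!: ennreal_leI)
  also have "\<dots> = ennreal ?M * ennreal (rl_kernel (\<alpha> + 1) t)"
    using assms by (simp add: nn_integral_cmult nn_conv_rl_kernel)
  also have "\<dots> = ennreal (?M * rl_kernel (\<alpha> + 1) t)" using M by (simp add: ennreal_mult')
  also have "\<dots> \<le> ennreal (?M * rl_kernel (\<alpha> + 1) L)"
    using assms M by (intro ennreal_leI mult_left_mono rl_kernel_mono) auto
  finally show ?thesis .
qed

text \<open>
  Convolving the series term by term raises each index by \<open>\<alpha>\<close> and produces the exponential series
  without its constant term.
\<close>

lemma conv_temper_kernel:
  assumes "0 < \<alpha>"
  shows "conv (rl_kernel \<alpha>) (temper_kernel \<alpha> \<sigma>) t = (exp (\<sigma> * t) - 1) * rl_kernel \<alpha> t"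
proof -
  let ?c = "temper_coeff \<alpha> \<sigma>"
  let ?f = "\<lambda>j r. rl_kernel \<alpha> (t - r) * (?c j * rl_kernel (real (Suc j)) r)"
  have G: "0 < Gamma \<alpha>" using assms by (rule Gamma_real_pos)
  have f: "?f j r = ?c j * (rl_kernel \<alpha> (t - r) * rl_kernel (real (Suc j)) r)" for j r by simp
  have nf: "norm (?f j r) = \<bar>?c j\<bar> * (rl_kernel \<alpha> (t - r) * rl_kernel (real (Suc j)) r)" for j r
    using rl_kernel_nonneg[OF assms, of "t - r"] rl_kernel_nonneg[of "real (Suc j)" r]
    by (simp add: abs_mult)
  have int: "integrable lborel (?f j)" for j
    unfolding f using assms by (intro integrable_mult_right impI conv_rl_kernel) auto
  have val: "?c j * rl_kernel (\<alpha> + real (Suc j)) t = rl_kernel \<alpha> t * ((\<sigma> * t) ^ Suc j / fact (Suc j))" for j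
  proof (cases "0 < t")
    case True
    have G: "0 < Gamma (\<alpha> + real (Suc j))" using assms by (intro Gamma_real_pos) simp
    have "t powr (\<alpha> + real (Suc j) - 1) = t powr (\<alpha> - 1) * t powr real (Suc j)"
      by (simp flip: powr_add add: algebra_simps)
    also have "t powr real (Suc j) = t ^ Suc j" using True by (rule powr_realpow)
    finally have "t powr (\<alpha> + real (Suc j) - 1) = t powr (\<alpha> - 1) * t ^ Suc j" .
    then show ?thesis using True G
      by (simp add: rl_kernel_def temper_coeff_def power_mult_distrib mult_ac del: of_nat_Suc power_Suc fact_Suc)
  qed (simp add: rl_kernel_nonpos)
  have exps: "(\<lambda>j. x ^ Suc j / fact (Suc j)) sums (exp x - 1)" for x :: real
  proof -
    have "(\<lambda>j. x ^ j / fact j) sums exp x"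
      using exp_converges[of x] by (simp add: divide_inverse mult.commute)
    then show ?thesis by (subst sums_Suc_iff) simp
  qed
  have inf: "(LINT r|lborel. ?f j r) = rl_kernel \<alpha> t * ((\<sigma> * t) ^ Suc j / fact (Suc j))" for j
  proof -
    have "(LINT r|lborel. ?f j r) = ?c j * conv (rl_kernel \<alpha>) (rl_kernel (real (Suc j))) t"
      by (simp only: f conv_def integral_mult_right_zero)
    also have "\<dots> = rl_kernel \<alpha> t * ((\<sigma> * t) ^ Suc j / fact (Suc j))"
      using assms by (subst conv_rl_kernel(2)) (simp_all only: val of_nat_0_less_iff zero_less_Suc)
    finally show ?thesis .
  qed
  have intn: "(LINT r|lborel. norm (?f j r)) = \<bar>rl_kernel \<alpha> t * ((\<sigma> * t) ^ Suc j / fact (Suc j))\<bar>" for j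
  proof -
    have "(LINT r|lborel. norm (?f j r)) = \<bar>?c j\<bar> * rl_kernel (\<alpha> + real (Suc j)) t"
    proof -
      have "(LINT r|lborel. norm (?f j r)) = \<bar>?c j\<bar> * conv (rl_kernel \<alpha>) (rl_kernel (real (Suc j))) t"
        by (simp only: nf conv_def integral_mult_right_zero)
      then show ?thesis using assms by (subst (asm) conv_rl_kernel(2)) simp_all
    qed
    also have "\<dots> = \<bar>?c j * rl_kernel (\<alpha> + real (Suc j)) t\<bar>"
      using assms rl_kernel_nonneg[of "\<alpha> + real (Suc j)" t] by (simp add: abs_mult)
    finally show ?thesis unfolding val .
  qed
  have "(\<lambda>j. LINT r|lborel. ?f j r) sums (LINT r|lborel. (\<Sum>j. ?f j r))"
  proof (rule sums_integral[OF int])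
    show "AE r in lborel. summable (\<lambda>j. norm (?f j r))"
    proof (rule AE_I2)
      fix r
      have "summable (\<lambda>j. rl_kernel \<alpha> (t - r) * (\<bar>?c j\<bar> * rl_kernel (real (Suc j)) r))"
        by (intro summable_mult summable_temper_coeff assms)
      then show "summable (\<lambda>j. norm (?f j r))" unfolding nf by (simp add: mult_ac)
    qed
    have "summable (\<lambda>j. \<bar>rl_kernel \<alpha> t\<bar> * (\<bar>\<sigma> * t\<bar> ^ Suc j / fact (Suc j)))"
      using exps[of "\<bar>\<sigma> * t\<bar>"] by (intro summable_mult) (simp add: sums_iff)
    then show "summable (\<lambda>j. LINT r|lborel. norm (?f j r))"
      unfolding intn by (simp add: abs_mult power_abs power_mult_distrib)
  qed
  moreover have "(\<lambda>j. LINT r|lborel. ?f j r) sums (rl_kernel \<alpha> t * (exp (\<sigma> * t) - 1))"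
    unfolding inf by (intro sums_mult exps)
  moreover have "(\<Sum>j. ?f j r) = rl_kernel \<alpha> (t - r) * temper_kernel \<alpha> \<sigma> r" for r
  proof -
    have "summable (\<lambda>j. norm (?c j * rl_kernel (real (Suc j)) r))"
      using summable_temper_coeff[OF assms, of \<sigma> r] by (simp add: abs_mult rl_kernel_nonneg)
    then show ?thesis unfolding temper_kernel_def by (intro suminf_mult) (rule summable_norm_cancel)
  qed
  ultimately show ?thesis
    using sums_unique2 unfolding conv_def by (simp add: mult.commute)
qed

section \<open>The fractional derivative recovers the density\<close>

text \<open>
  Densities are only Lebesgue measurable on \<open>[a, b]\<close> and arbitrary outside. Convolution and Fubini's
  theorem are applied to a Borel representative that vanishes outside the interval.
\<close>

definition borel_version :: "real \<Rightarrow> real \<Rightarrow> (real \<Rightarrow> real) \<Rightarrow> (real \<Rightarrow> real) \<Rightarrow> bool" where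
  "borel_version a b v v' \<longleftrightarrow> v' \<in> borel_measurable borel \<and> (\<forall>x. x \<notin> {a..b} \<longrightarrow> v' x = 0) \<and>
     (AE x in lebesgue_on {a..b}. v x = v' x)"

lemma AE_lebesgue_on_Icc:
  fixes a b :: real
  shows "(AE x in lebesgue_on {a..b}. P x) \<longleftrightarrow> (AE x in lebesgue. x \<in> {a..b} \<longrightarrow> P x)"
  by (rule AE_restrict_space_iff) simp

lemma ex_borel_version:
  assumes "v \<in> borel_measurable (lebesgue_on {a..b})"
  shows "\<exists>v'. borel_version a b v v'"
proof -
  have "(\<lambda>x. if x \<in> {a..b} then v x else 0) \<in> borel_measurable lebesgue"
    using assms by (subst borel_measurable_if) auto
  then obtain g where g: "g \<in> borel_measurable lborel"
    "AE x in lborel. (if x \<in> {a..b} then v x else 0) = g x"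
    using completion_ex_borel_measurable_real by blast
  have "borel_version a b v (\<lambda>x. indicator {a..b} x * g x)"
    unfolding borel_version_def AE_lebesgue_on_Icc
  proof (intro conjI)
    show "AE x in lebesgue. x \<in> {a..b} \<longrightarrow> v x = indicator {a..b} x * g x"
      using AE_completion[OF g(2)] by eventually_elim auto
  qed (use g in auto)
  then show ?thesis by blast
qed

lemma borel_version_integral:
  assumes "borel_version a b v v'"
  shows "integrable (lebesgue_on {a..b}) v \<longleftrightarrow> integrable lborel v'"
    and "(LINT x|lebesgue_on {a..b}. v x) = (LINT x|lborel. v' x)"
    and "v \<in> borel_measurable (lebesgue_on {a..b})"
proof -
  have v': "v' \<in> borel_measurable borel" "\<And>x. x \<notin> {a..b} \<Longrightarrow> v' x = 0"
    and ae: "AE x in lebesgue. x \<in> {a..b} \<longrightarrow> v x = v' x"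
    using assms unfolding borel_version_def AE_lebesgue_on_Icc by auto
  have AE: "AE x in lebesgue. v' x = indicator {a..b} x *\<^sub>R v x"
    using ae by eventually_elim (use v'(2) in \<open>auto split: split_indicator\<close>)
  have mv': "v' \<in> borel_measurable lebesgue" using v'(1) by (intro measurable_completion) auto
  have m: "(\<lambda>x. indicator {a..b} x *\<^sub>R v x) \<in> borel_measurable lebesgue"
    by (rule borel_measurable_AE[OF mv' AE])
  then have "(\<lambda>x. if x \<in> {a..b} then v x else 0) \<in> borel_measurable lebesgue"
    by (rule measurable_cong[THEN iffD1, rotated]) (simp add: indicator_def)
  then show "v \<in> borel_measurable (lebesgue_on {a..b})" by (rule borel_measurable_if_D)
  have "integrable (lebesgue_on {a..b}) v \<longleftrightarrow> integrable lebesgue (\<lambda>x. indicator {a..b} x *\<^sub>R v x)"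
    by (rule integrable_restrict_space) simp
  also have "\<dots> \<longleftrightarrow> integrable lebesgue v'"
    using AE by (intro integrable_cong_AE m mv') auto
  also have "\<dots> \<longleftrightarrow> integrable lborel v'"
    using v'(1) by (intro integrable_completion) simp
  finally show "integrable (lebesgue_on {a..b}) v \<longleftrightarrow> integrable lborel v'" .
  have "(LINT x|lebesgue_on {a..b}. v x) = (LINT x|lebesgue. indicator {a..b} x *\<^sub>R v x)"
    by (rule integral_restrict_space) simp
  also have "\<dots> = (LINT x|lebesgue. v' x)"
    using AE by (intro integral_cong_AE m mv') auto
  also have "\<dots> = (LINT x|lborel. v' x)"
    using v'(1) by (intro integral_completion) simp
  finally show "(LINT x|lebesgue_on {a..b}. v x) = (LINT x|lborel. v' x)" .
qed

lemma frac_int_eq_conv: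
  assumes v': "borel_version a b v v'" and "x \<le> b"
  shows "frac_int a \<beta> v x = conv (rl_kernel \<beta>) v' x"
proof -
  have [measurable]: "v' \<in> borel_measurable borel" and v0: "\<And>x. x \<notin> {a..b} \<Longrightarrow> v' x = 0"
    and ae: "AE x in lebesgue. x \<in> {a..b} \<longrightarrow> v x = v' x"
    using assms unfolding borel_version_def AE_lebesgue_on_Icc by auto
  have "borel_version a x (\<lambda>s. (x - s) powr (\<beta> - 1) * v s) (\<lambda>s. indicator {a..x} s * ((x - s) powr (\<beta> - 1) * v' s))"
    unfolding borel_version_def AE_lebesgue_on_Icc
  proof (intro conjI)
    show "AE s in lebesgue. s \<in> {a..x} \<longrightarrow> (x - s) powr (\<beta> - 1) * v s = indicator {a..x} s * ((x - s) powr (\<beta> - 1) * v' s)"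
      using ae by eventually_elim (use \<open>x \<le> b\<close> in auto)
  qed auto
  from borel_version_integral(2)[OF this]
  have "frac_int a \<beta> v x = 1 / Gamma \<beta> * (LINT s|lborel. indicator {a..x} s * ((x - s) powr (\<beta> - 1) * v' s))"
    by (simp add: frac_int_def)
  also have "\<dots> = (LINT s|lborel. 1 / Gamma \<beta> * (indicator {a..x} s * ((x - s) powr (\<beta> - 1) * v' s)))"
    by simp
  also have "\<dots> = conv (rl_kernel \<beta>) v' x"
    unfolding conv_def
  proof (rule Bochner_Integration.integral_cong)
    fix s
    show "1 / Gamma \<beta> * (indicator {a..x} s * ((x - s) powr (\<beta> - 1) * v' s)) = rl_kernel \<beta> (x - s) * v' s"
      using v0[of s] by (cases s x rule: linorder_cases) (auto simp: rl_kernel_def split: split_indicator)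
  qed simp
  finally show ?thesis .
qed

lemma conv_eq_0_left:
  assumes "\<And>t. t \<le> 0 \<Longrightarrow> f t = 0" "\<And>s. s < a \<Longrightarrow> g s = 0" "x < a"
  shows "conv f g x = 0"
proof -
  have "f (x - s) * g s = 0" for s using assms by (cases "s < a") auto
  then show ?thesis by (simp only: conv_def integral_zero)
qed

lemma conv_rl_kernel_assoc:
  assumes "0 < \<alpha>" "0 < \<beta>" "1 \<le> \<alpha> + \<beta>" and \<phi>: "integrable lborel \<phi>" "\<And>s. s < a \<Longrightarrow> \<phi> s = 0"
  shows "integrable lborel (\<lambda>y. rl_kernel \<beta> (x - y) * conv (rl_kernel \<alpha>) \<phi> y)"
    and "conv (rl_kernel \<beta>) (conv (rl_kernel \<alpha>) \<phi>) x = conv (rl_kernel (\<alpha> + \<beta>)) \<phi> x"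
proof -
  have b: "(\<integral>\<^sup>+r. ennreal \<bar>rl_kernel \<beta> (t - r) * rl_kernel \<alpha> r\<bar> \<partial>lborel) \<le> ennreal (rl_kernel (\<alpha> + \<beta>) (x - a))"
    if "t \<le> x - a" for t
  proof -
    have "\<bar>rl_kernel \<beta> (t - r) * rl_kernel \<alpha> r\<bar> = rl_kernel \<beta> (t - r) * rl_kernel \<alpha> r" for r
      using assms by (intro abs_of_nonneg mult_nonneg_nonneg rl_kernel_nonneg)
    then show ?thesis
      using that assms
      by (auto simp: nn_conv_rl_kernel add.commute intro!: ennreal_leI rl_kernel_mono)
  qed
  note assoc = conv_assoc[of "rl_kernel \<beta>" "rl_kernel \<alpha>" \<phi> a, OF _ _ \<phi> b, simplified]
  show "integrable lborel (\<lambda>y. rl_kernel \<beta> (x - y) * conv (rl_kernel \<alpha>) \<phi> y)"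
    by (rule assoc(2))
  have "conv (rl_kernel \<beta>) (rl_kernel \<alpha>) = rl_kernel (\<alpha> + \<beta>)"
    using assms by (intro ext) (simp add: conv_rl_kernel add.commute)
  then show "conv (rl_kernel \<beta>) (conv (rl_kernel \<alpha>) \<phi>) x = conv (rl_kernel (\<alpha> + \<beta>)) \<phi> x"
    using assoc(3) by simp
qed

text \<open>
  The semigroup law holds at every \<open>x\<close>, although \<open>u\<close> is prescribed only almost everywhere, because the
  outer integral ignores null sets.
\<close>

lemma frac_int_frac_int:
  assumes "0 < \<alpha>" "0 < \<beta>" "1 \<le> \<alpha> + \<beta>" "x \<le> b"
    and \<phi>: "borel_version a b \<phi> \<phi>'" "integrable lborel \<phi>'"
    and u: "is_frac_int_of a b \<alpha> u \<phi>"
  shows "frac_int a \<beta> u x = conv (rl_kernel (\<alpha> + \<beta>)) \<phi>' x"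
proof -
  have \<phi>0: "\<phi>' s = 0" if "s < a" for s using \<phi>(1) that by (simp add: borel_version_def)
  have [measurable]: "\<phi>' \<in> borel_measurable borel" using \<phi>(1) by (simp add: borel_version_def)
  let ?u = "\<lambda>y. indicator {a..b} y * conv (rl_kernel \<alpha>) \<phi>' y"
  have "borel_version a b u ?u"
    unfolding borel_version_def AE_lebesgue_on_Icc
  proof (intro conjI)
    have "AE y in lebesgue. y \<in> {a..b} \<longrightarrow> u y = frac_int a \<alpha> \<phi> y"
      using u by (simp add: is_frac_int_of_def AE_lebesgue_on_Icc)
    then show "AE y in lebesgue. y \<in> {a..b} \<longrightarrow> u y = ?u y"
      by eventually_elim (auto simp: frac_int_eq_conv[OF \<phi>(1)])
  qed auto
  then have "frac_int a \<beta> u x = conv (rl_kernel \<beta>) ?u x"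
    using \<open>x \<le> b\<close> by (rule frac_int_eq_conv)
  also have "\<dots> = conv (rl_kernel \<beta>) (conv (rl_kernel \<alpha>) \<phi>') x"
    unfolding conv_def[of "rl_kernel \<beta>"]
  proof (rule Bochner_Integration.integral_cong)
    fix y
    have "conv (rl_kernel \<alpha>) \<phi>' y = 0" if "y < a"
      using \<phi>0 that by (intro conv_eq_0_left) (auto simp: rl_kernel_nonpos)
    then show "rl_kernel \<beta> (x - y) * ?u y = rl_kernel \<beta> (x - y) * conv (rl_kernel \<alpha>) \<phi>' y"
      using \<open>x \<le> b\<close> by (cases "y \<le> b") (auto simp: rl_kernel_nonpos split: split_indicator)
  qed simp
  also have "\<dots> = conv (rl_kernel (\<alpha> + \<beta>)) \<phi>' x"
    using assms \<phi>0 by (intro conv_rl_kernel_assoc) auto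
  finally show ?thesis .
qed

text \<open>
  Convolution with \<open>K\<^sub>1\<close> is integration from \<open>a\<close>; this gives access to the fundamental theorem of
  calculus for the gauge integral.
\<close>

lemma conv_rl_kernel_1:
  fixes g :: "real \<Rightarrow> real"
  assumes [measurable]: "g \<in> borel_measurable borel" and g0: "\<And>s. s < a \<Longrightarrow> g s = 0"
    and int: "integrable lborel (\<lambda>y. rl_kernel 1 (c - y) * g y)"
  shows "g integrable_on {a..c}"
    and "x \<le> c \<Longrightarrow> conv (rl_kernel 1) g x = integral {a..x} g"
proof -
  have eq: "AE y in lborel. rl_kernel 1 (x - y) * g y = indicator {a..x} y *\<^sub>R g y" for x
    using AE_lborel_singleton[of x]
    by eventually_elim (use g0 in \<open>auto simp: rl_kernel_def split: split_indicator\<close>)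
  have si: "set_integrable lborel {a..c} g"
    unfolding set_integrable_def
    using int eq[of c] by (subst integrable_cong_AE[symmetric]) auto
  show "g integrable_on {a..c}" using set_borel_integral_eq_integral(1)[OF si] .
  assume "x \<le> c"
  then have si': "set_integrable lborel {a..x} g"
    by (intro set_integrable_subset[OF si]) auto
  have "conv (rl_kernel 1) g x = (LINT y:{a..x}|lborel. g y)"
    unfolding conv_def set_lebesgue_integral_def using eq[of x] by (intro integral_cong_AE) auto
  also have "\<dots> = integral {a..x} g" by (rule set_borel_integral_eq_integral(2)[OF si'])
  finally show "conv (rl_kernel 1) g x = integral {a..x} g" .
qed

text \<open>
  The orders are at least \<open>2\<close> and \<open>1\<close>: the function differentiated is a primitive of \<open>K\<^sub>n\<^sub>+\<^sub>1 \<star> \<phi>\<close>, which is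
  itself an indefinite integral and therefore continuous.
\<close>

lemma deriv_conv_rl_kernel:
  assumes \<phi>: "integrable lborel \<phi>" "\<And>s. s < a \<Longrightarrow> \<phi> s = 0" and "a < x"
  shows "(conv (rl_kernel (real (Suc (Suc n)))) \<phi> has_real_derivative conv (rl_kernel (real (Suc n))) \<phi> x) (at x)"
proof -
  have [measurable]: "\<phi> \<in> borel_measurable borel" using \<phi> by auto
  define c where "c = x + 1"
  let ?J = "\<lambda>n. conv (rl_kernel (real (Suc n))) \<phi>"
  have J0: "?J n s = 0" if "s < a" for n s
    using \<phi>(2) that by (intro conv_eq_0_left) (auto simp: rl_kernel_nonpos)
  have Jint: "integrable lborel (\<lambda>y. rl_kernel 1 (c - y) * ?J n y)" for n
    using conv_rl_kernel_assoc(1)[of "real (Suc n)" 1 \<phi> a c] \<phi> by auto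
  have Jstep: "conv (rl_kernel 1) (?J n) = ?J (Suc n)" for n
  proof
    fix y
    show "conv (rl_kernel 1) (?J n) y = ?J (Suc n) y"
      using conv_rl_kernel_assoc(2)[of "real (Suc n)" 1 \<phi> a y] \<phi> by (simp add: add.commute)
  qed
  have cont1: "continuous_on {a..c} (conv (rl_kernel 1) g)"
    if "g \<in> borel_measurable borel" "\<And>s. s < a \<Longrightarrow> g s = 0" "integrable lborel (\<lambda>y. rl_kernel 1 (c - y) * g y)"
    for g :: "real \<Rightarrow> real"
  proof -
    have "continuous_on {a..c} (\<lambda>x. integral {a..x} g)"
      by (rule indefinite_integral_continuous_1) (rule conv_rl_kernel_1(1)[OF that])
    then show ?thesis
      by (rule continuous_on_cong[THEN iffD1, rotated 2]) (auto simp: conv_rl_kernel_1(2)[OF that])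
  qed
  have "continuous_on {a..c} (?J n)"
  proof (cases n)
    case 0
    have "integrable lborel (\<lambda>y. indicator {..<c} y *\<^sub>R \<phi> y)"
      using \<phi>(1) by (intro integrable_mult_indicator) auto
    moreover have "indicator {..<c} y *\<^sub>R \<phi> y = rl_kernel 1 (c - y) * \<phi> y" for y
      by (auto simp: rl_kernel_def split: split_indicator)
    ultimately have "integrable lborel (\<lambda>y. rl_kernel 1 (c - y) * \<phi> y)" by (simp only:)
    then show ?thesis unfolding 0 using \<phi>(2) cont1[of \<phi>] by simp
  next
    case (Suc k)
    show ?thesis unfolding Suc Jstep[symmetric] by (rule cont1) (use J0 Jint in auto)
  qed
  then have "((\<lambda>x. integral {a..x} (?J n)) has_real_derivative ?J n x) (at x within {a..c})"
    by (rule integral_has_real_derivative) (use \<open>a < x\<close> in \<open>auto simp: c_def\<close>)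
  moreover have "at x within {a..c} = at x"
    by (rule at_within_interior) (use \<open>a < x\<close> in \<open>auto simp: c_def\<close>)
  ultimately have "((\<lambda>x. integral {a..x} (?J n)) has_real_derivative ?J n x) (at x)" by simp
  then show ?thesis
  proof (rule has_field_derivative_transform_within_open)
    show "x \<in> {..<c}" by (simp add: c_def)
    show "integral {a..y} (?J n) = ?J (Suc n) y" if "y \<in> {..<c}" for y
      using that conv_rl_kernel_1(2)[of "?J n" a c y] J0 Jint unfolding Jstep by simp
  qed simp
qed

text \<open>
  The function \<open>f\<close> is known only on the open interval, so the induction generalises over \<open>f\<close> and uses
  that derivatives are local.
\<close>

lemma iterated_deriv_conv_rl_kernel:
  assumes \<phi>: "integrable lborel \<phi>" "\<And>s. s < a \<Longrightarrow> \<phi> s = 0"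
    and f: "\<And>x. x \<in> {a<..<b} \<Longrightarrow> f x = conv (rl_kernel (real (Suc n))) \<phi> x"
    and "x \<in> {a<..<b}"
  shows "(deriv ^^ n) f x = conv (rl_kernel 1) \<phi> x"
  using f
proof (induction n arbitrary: f)
  case 0
  then show ?case using \<open>x \<in> {a<..<b}\<close> by simp
next
  case (Suc n)
  have "deriv f y = conv (rl_kernel (real (Suc n))) \<phi> y" if y: "y \<in> {a<..<b}" for y
  proof -
    have "(f has_real_derivative conv (rl_kernel (real (Suc n))) \<phi> y) (at y)"
    proof (rule has_field_derivative_transform_within_open[where S = "{a<..<b}"])
      show "(conv (rl_kernel (real (Suc (Suc n)))) \<phi> has_real_derivative conv (rl_kernel (real (Suc n))) \<phi> y) (at y)"
        using y by (intro deriv_conv_rl_kernel[OF \<phi>]) auto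
    qed (use y Suc.prems in auto)
    then show ?thesis by (rule DERIV_imp_deriv)
  qed
  from Suc.IH[OF this] show ?case by (simp only: funpow_Suc_right o_apply)
qed

text \<open>
  The key identification of derivative and density. After \<open>\<lfloor>\<alpha>\<rfloor>\<close> classical derivatives the iterated
  integral is reduced to the indefinite integral of \<open>\<phi>\<close>, and the one remaining derivative is covered
  by Lebesgue's theorem.
\<close>

lemma frac_deriv_frac_int:
  assumes "0 < \<alpha>" and \<phi>: "integrable (lebesgue_on {a..b}) \<phi>" and u: "is_frac_int_of a b \<alpha> u \<phi>"
  shows "AE x in lebesgue_on {a..b}. frac_deriv a \<alpha> u x = \<phi> x"
proof -
  obtain \<phi>' where ver: "borel_version a b \<phi> \<phi>'"
    using ex_borel_version[of \<phi> a b] \<phi> by auto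
  have int: "integrable lborel \<phi>'" using borel_version_integral(1)[OF ver] \<phi> by simp
  have [measurable]: "\<phi>' \<in> borel_measurable borel" using int by auto
  have \<phi>0: "\<phi>' s = 0" if "s < a" for s using ver that by (simp add: borel_version_def)
  \<comment> \<open>The integration order \<open>N + 1 - \<alpha>\<close> is positive, and it adds up with \<open>\<alpha>\<close> to \<open>N + 1\<close>.\<close>
  define N where "N = nat \<lfloor>\<alpha>\<rfloor>"
  define f where "f = frac_int a (real (Suc N) - \<alpha>) u"
  have N: "0 < real (Suc N) - \<alpha>" unfolding N_def using \<open>0 < \<alpha>\<close> by simp linarith
  have "f x = conv (rl_kernel (real (Suc N))) \<phi>' x" if "x \<le> b" for x
    unfolding f_def using frac_int_frac_int[OF \<open>0 < \<alpha>\<close> N _ that ver int u] by simp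
  then have iter: "(deriv ^^ N) f x = conv (rl_kernel 1) \<phi>' x" if "x \<in> {a<..<b}" for x
    using that by (intro iterated_deriv_conv_rl_kernel[OF int \<phi>0]) auto
  have prim: "conv (rl_kernel 1) \<phi>' x = (LINT s:{..x}|lborel. \<phi>' s)" for x
    unfolding conv_def set_lebesgue_integral_def
  proof (rule integral_cong_AE)
    show "AE s in lborel. rl_kernel 1 (x - s) * \<phi>' s = indicator {..x} s *\<^sub>R \<phi>' s"
      using AE_lborel_singleton[of x]
      by eventually_elim (auto simp: rl_kernel_def split: split_indicator)
  qed auto
  have fd: "frac_deriv a \<alpha> u = deriv ((deriv ^^ N) f)"
    by (simp add: frac_deriv_def Let_def f_def N_def)
  have "AE x in lebesgue. ((\<lambda>t. LINT s:{..t}|lborel. \<phi>' s) has_real_derivative \<phi>' x) (at x)"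
    by (rule AE_completion[OF lebesgue_differentiation[OF int]])
  moreover have "AE x in lebesgue. x \<noteq> a" "AE x in lebesgue. x \<noteq> b"
    by (rule AE_completion[OF AE_lborel_singleton])+
  moreover have "AE x in lebesgue. x \<in> {a..b} \<longrightarrow> \<phi> x = \<phi>' x"
    using ver by (simp add: borel_version_def AE_lebesgue_on_Icc)
  ultimately have "AE x in lebesgue. x \<in> {a..b} \<longrightarrow> frac_deriv a \<alpha> u x = \<phi> x"
  proof eventually_elim
    case (elim x)
    show ?case
    proof
      assume "x \<in> {a..b}"
      then have x: "x \<in> {a<..<b}" using elim by auto
      have "((deriv ^^ N) f has_real_derivative \<phi>' x) (at x)"
        using elim(1) by (rule has_field_derivative_transform_within_open[OF _ _ x]) (auto simp: iter prim)
      then show "frac_deriv a \<alpha> u x = \<phi> x"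
        unfolding fd using elim(4) \<open>x \<in> {a..b}\<close> by (simp add: DERIV_imp_deriv)
    qed
  qed
  then show ?thesis by (simp add: AE_lebesgue_on_Icc)
qed

section \<open>The density of an exponentially weighted fractional integral\<close>

text \<open>
  The two integrands differ from the common term \<open>K\<^sub>\<alpha> (x - s) g s\<close> by integrable functions with equal
  integrals. If the common term is integrable, the integrals agree by additivity; otherwise both
  integrands fail to be integrable and both sides are \<open>0\<close> by convention. So the equality holds at every
  point.
\<close>

lemma conv_exp_rl_kernel:
  assumes "0 < \<alpha>" and g: "integrable lborel g" "\<And>s. s < a \<Longrightarrow> g s = 0"
  shows "conv (\<lambda>t. exp (\<sigma> * t) * rl_kernel \<alpha> t) g x
       = conv (rl_kernel \<alpha>) (\<lambda>s. g s + conv (temper_kernel \<alpha> \<sigma>) g s) x"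
proof -
  let ?K = "rl_kernel \<alpha>" and ?m = "temper_kernel \<alpha> \<sigma>"
  let ?P = "\<lambda>s. ?K (x - s) * g s"
  let ?Q = "\<lambda>s. conv ?K ?m (x - s) * g s"
  let ?R = "\<lambda>s. ?K (x - s) * conv ?m g s"
  note assoc = conv_assoc[of ?K ?m g a x,
      OF rl_kernel_measurable temper_kernel_measurable g nn_conv_temper_kernel_le[OF \<open>0 < \<alpha>\<close>]]
  have Q: "integrable lborel ?Q" and R: "integrable lborel ?R"
    and QR: "integral\<^sup>L lborel ?R = integral\<^sup>L lborel ?Q"
    using assoc by (simp_all add: conv_def)
  have l: "conv (\<lambda>t. exp (\<sigma> * t) * ?K t) g x = (LINT s|lborel. ?P s + ?Q s)"
    unfolding conv_temper_kernel[OF \<open>0 < \<alpha>\<close>] by (simp add: conv_def algebra_simps)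
  have r: "conv ?K (\<lambda>s. g s + conv ?m g s) x = (LINT s|lborel. ?P s + ?R s)"
    by (simp add: conv_def[of ?K] algebra_simps)
  show ?thesis
  proof (cases "integrable lborel ?P")
    case True
    then show ?thesis unfolding l r using Q R QR by simp
  next
    case False
    have "\<not> integrable lborel (\<lambda>s. ?P s + ?Q s)"
      using Bochner_Integration.integrable_diff[OF _ Q, of "\<lambda>s. ?P s + ?Q s"] False by auto
    moreover have "\<not> integrable lborel (\<lambda>s. ?P s + ?R s)"
      using Bochner_Integration.integrable_diff[OF _ R, of "\<lambda>s. ?P s + ?R s"] False by auto
    ultimately show ?thesis unfolding l r by (simp add: not_integrable_integral_eq)
  qed
qed

lemma abs_conv_temper_kernel_le:
  assumes "0 < \<alpha>" and g: "integrable lborel g" "\<And>s. s < a \<Longrightarrow> g s = 0" and "x \<le> b"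
  shows "\<bar>conv (temper_kernel \<alpha> \<sigma>) g x\<bar> \<le> temper_bound \<alpha> \<sigma> (b - a) * (LINT s|lborel. \<bar>g s\<bar>)"
proof -
  have "\<bar>conv (temper_kernel \<alpha> \<sigma>) g x\<bar> \<le> (LINT s|lborel. temper_bound \<alpha> \<sigma> (b - a) * \<bar>g s\<bar>)"
    unfolding conv_def real_norm_def[symmetric]
  proof (rule Bochner_Integration.integral_norm_bound_integral)
    have pt: "norm (temper_kernel \<alpha> \<sigma> (x - s) * g s) \<le> temper_bound \<alpha> \<sigma> (b - a) * norm (g s)" for s
    proof (cases "s < a")
      case False
      then show ?thesis using assms abs_temper_kernel_le[of \<alpha> "x - s" "b - a" \<sigma>]
        by (auto simp: abs_mult intro!: mult_right_mono)
    qed (simp add: g)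
    show i: "integrable lborel (\<lambda>s. temper_bound \<alpha> \<sigma> (b - a) * norm (g s))" using g(1) by auto
    show "integrable lborel (\<lambda>s. temper_kernel \<alpha> \<sigma> (x - s) * g s)"
    proof (rule Bochner_Integration.integrable_bound[OF i])
      show "(\<lambda>s. temper_kernel \<alpha> \<sigma> (x - s) * g s) \<in> borel_measurable lborel"
        using g(1) by measurable
      show "AE s in lborel. norm (temper_kernel \<alpha> \<sigma> (x - s) * g s) \<le> norm (temper_bound \<alpha> \<sigma> (b - a) * norm (g s))"
        using pt temper_bound_nonneg[OF \<open>0 < \<alpha>\<close>, of \<sigma> "b - a"] by (auto intro!: AE_I2 simp: abs_mult)
    qed
    show "norm (temper_kernel \<alpha> \<sigma> (x - s) * g s) \<le> temper_bound \<alpha> \<sigma> (b - a) * norm (g s)" for s by (rule pt)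
  qed
  then show ?thesis by simp
qed

definition exp_bound :: "real \<Rightarrow> real \<Rightarrow> real \<Rightarrow> real" where
  "exp_bound a b \<sigma> = exp (\<bar>\<sigma>\<bar> * (\<bar>a\<bar> + \<bar>b\<bar>))"

lemma exp_le_exp_bound: "x \<in> {a..b} \<Longrightarrow> exp (\<sigma> * x) \<le> exp_bound a b \<sigma>"
proof -
  assume x: "x \<in> {a..b}"
  have "\<sigma> * x \<le> \<bar>\<sigma>\<bar> * \<bar>x\<bar>" by (simp flip: abs_mult)
  also have "\<dots> \<le> \<bar>\<sigma>\<bar> * (\<bar>a\<bar> + \<bar>b\<bar>)" using x by (intro mult_left_mono) auto
  finally show ?thesis by (simp add: exp_bound_def)
qed

text \<open>
  The density is \<open>g + m \<star> g\<close> with \<open>g s = exp (\<sigma> s) \<phi> s\<close> and \<open>m\<close> the correction kernel. The pointwise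
  bound does not mention \<open>p\<close>, which makes the final constants uniform in \<open>p\<close>.
\<close>

lemma tempered_density:
  assumes "0 < \<alpha>" and \<phi>: "integrable (lebesgue_on {a..b}) \<phi>" and u: "is_frac_int_of a b \<alpha> u \<phi>"
  obtains \<psi> where "\<psi> \<in> borel_measurable (lebesgue_on {a..b})"
    "is_frac_int_of a b \<alpha> (\<lambda>x. exp (\<sigma> * x) * u x) \<psi>"
    "AE x in lebesgue_on {a..b}. \<bar>\<psi> x\<bar> \<le> exp_bound a b \<sigma> * \<bar>\<phi> x\<bar>
       + temper_bound \<alpha> \<sigma> (b - a) * exp_bound a b \<sigma> * (LINT s|lebesgue_on {a..b}. \<bar>\<phi> s\<bar>)"
proof -
  obtain \<phi>' where ver: "borel_version a b \<phi> \<phi>'"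
    using ex_borel_version[of \<phi> a b] \<phi> by auto
  have int: "integrable lborel \<phi>'" using borel_version_integral(1)[OF ver] \<phi> by simp
  have [measurable]: "\<phi>' \<in> borel_measurable borel" using int by auto
  have \<phi>0: "\<phi>' s = 0" if "s \<notin> {a..b}" for s using ver that by (simp add: borel_version_def)
  let ?E = "exp_bound a b \<sigma>" and ?M = "temper_bound \<alpha> \<sigma> (b - a)"
  let ?J = "LINT s|lebesgue_on {a..b}. \<bar>\<phi> s\<bar>"
  have E: "0 < ?E" by (simp add: exp_bound_def)
  have M: "0 \<le> ?M" using \<open>0 < \<alpha>\<close> by (rule temper_bound_nonneg)
  define g where "g s = exp (\<sigma> * s) * \<phi>' s" for s
  define \<psi> where "\<psi> x = indicator {a..b} x * (g x + conv (temper_kernel \<alpha> \<sigma>) g x)" for x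
  have [measurable]: "g \<in> borel_measurable borel" unfolding g_def by measurable
  have [measurable]: "\<psi> \<in> borel_measurable borel" unfolding \<psi>_def by measurable
  have g0: "g s = 0" if "s < a" for s using that by (simp add: g_def \<phi>0)
  have g_le: "\<bar>g s\<bar> \<le> ?E * \<bar>\<phi>' s\<bar>" for s
    using exp_le_exp_bound[of s a b \<sigma>] \<phi>0[of s]
    by (cases "s \<in> {a..b}") (auto simp: g_def abs_mult intro!: mult_right_mono)
  have gint: "integrable lborel g"
    by (rule Bochner_Integration.integrable_bound[of lborel "\<lambda>s. ?E * \<bar>\<phi>' s\<bar>"])
      (use int g_le E in \<open>auto simp: abs_mult\<close>)
  have J: "(LINT s|lborel. \<bar>\<phi>' s\<bar>) = ?J"
  proof -
    have "borel_version a b (\<lambda>s. \<bar>\<phi> s\<bar>) (\<lambda>s. \<bar>\<phi>' s\<bar>)"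
      using ver by (auto simp: borel_version_def elim!: eventually_mono)
    then show ?thesis by (simp add: borel_version_integral(2))
  qed
  have gJ: "(LINT s|lborel. \<bar>g s\<bar>) \<le> ?E * ?J"
  proof -
    have "(LINT s|lborel. \<bar>g s\<bar>) \<le> (LINT s|lborel. ?E * \<bar>\<phi>' s\<bar>)"
      using g_le gint int by (intro integral_mono) auto
    then show ?thesis by (simp add: J)
  qed
  have m0: "conv (temper_kernel \<alpha> \<sigma>) g s = 0" if "s < a" for s
    using g0 that by (intro conv_eq_0_left) (auto simp: temper_kernel_nonpos)
  have \<psi>ver: "borel_version a b \<psi> \<psi>"
    by (auto simp: borel_version_def \<psi>_def)
  have key: "frac_int a \<alpha> \<psi> x = exp (\<sigma> * x) * frac_int a \<alpha> \<phi> x" if "x \<le> b" for x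
  proof -
    have "frac_int a \<alpha> \<psi> x = conv (rl_kernel \<alpha>) \<psi> x"
      using \<psi>ver that by (rule frac_int_eq_conv)
    also have "\<dots> = conv (rl_kernel \<alpha>) (\<lambda>s. g s + conv (temper_kernel \<alpha> \<sigma>) g s) x"
      unfolding conv_def[of "rl_kernel \<alpha>"]
    proof (rule Bochner_Integration.integral_cong)
      fix s
      show "rl_kernel \<alpha> (x - s) * \<psi> s = rl_kernel \<alpha> (x - s) * (g s + conv (temper_kernel \<alpha> \<sigma>) g s)"
        using that by (cases "s \<le> b") (auto simp: \<psi>_def g0 m0 rl_kernel_nonpos split: split_indicator)
    qed simp
    also have "\<dots> = conv (\<lambda>t. exp (\<sigma> * t) * rl_kernel \<alpha> t) g x"
      using conv_exp_rl_kernel[OF \<open>0 < \<alpha>\<close> gint g0] by simp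
    also have "\<dots> = (LINT s|lborel. exp (\<sigma> * x) * (rl_kernel \<alpha> (x - s) * \<phi>' s))"
      unfolding conv_def
    proof (rule Bochner_Integration.integral_cong)
      fix s
      have "exp (\<sigma> * x) = exp (\<sigma> * (x - s)) * exp (\<sigma> * s)"
        by (simp flip: exp_add add: algebra_simps)
      then show "exp (\<sigma> * (x - s)) * rl_kernel \<alpha> (x - s) * g s = exp (\<sigma> * x) * (rl_kernel \<alpha> (x - s) * \<phi>' s)"
        by (simp add: g_def)
    qed simp
    also have "\<dots> = exp (\<sigma> * x) * frac_int a \<alpha> \<phi> x"
      using frac_int_eq_conv[OF ver that] by (simp add: conv_def)
    finally show ?thesis .
  qed
  show thesis
  proof
    show "\<psi> \<in> borel_measurable (lebesgue_on {a..b})" by (rule borel_version_integral(3)[OF \<psi>ver])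
    have "AE x in lebesgue. x \<in> {a..b} \<longrightarrow> u x = frac_int a \<alpha> \<phi> x"
      using u by (simp add: is_frac_int_of_def AE_lebesgue_on_Icc)
    then show "is_frac_int_of a b \<alpha> (\<lambda>x. exp (\<sigma> * x) * u x) \<psi>"
      unfolding is_frac_int_of_def AE_lebesgue_on_Icc by eventually_elim (auto simp: key)
    have "AE x in lebesgue. x \<in> {a..b} \<longrightarrow> \<phi> x = \<phi>' x"
      using ver by (simp add: borel_version_def AE_lebesgue_on_Icc)
    then show "AE x in lebesgue_on {a..b}. \<bar>\<psi> x\<bar> \<le> ?E * \<bar>\<phi> x\<bar> + ?M * ?E * ?J"
      unfolding AE_lebesgue_on_Icc
    proof eventually_elim
      case (elim x)
      show ?case
      proof
        assume x: "x \<in> {a..b}"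
        have "\<bar>conv (temper_kernel \<alpha> \<sigma>) g x\<bar> \<le> ?M * (LINT s|lborel. \<bar>g s\<bar>)"
          by (rule abs_conv_temper_kernel_le) (use \<open>0 < \<alpha>\<close> gint g0 x in auto)
        also have "\<dots> \<le> ?M * (?E * ?J)" using gJ M by (rule mult_left_mono)
        finally have "\<bar>conv (temper_kernel \<alpha> \<sigma>) g x\<bar> \<le> ?M * ?E * ?J" by (simp add: mult.assoc)
        moreover have "\<bar>g x\<bar> \<le> ?E * \<bar>\<phi> x\<bar>" using g_le[of x] elim x by simp
        ultimately show "\<bar>\<psi> x\<bar> \<le> ?E * \<bar>\<phi> x\<bar> + ?M * ?E * ?J"
          using x by (simp add: \<psi>_def)
      qed
    qed
  qed
qed

section \<open>Norm estimates\<close>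

lemma measure_lebesgue_on_Icc:
  fixes a b :: real
  assumes "a < b"
  shows "measure (lebesgue_on {a..b}) {a..b} = b - a"
  using assms by (simp add: measure_restrict_space)

text \<open>
  Measurability passes to \<open>f\<close> by completeness of Lebesgue measure.
\<close>

lemma Lp_space_cong_AE:
  assumes \<phi>: "\<phi> \<in> Lp_space p a b" and ae: "AE x in lebesgue_on {a..b}. f x = \<phi> x"
  shows "f \<in> Lp_space p a b" and "Lp_norm p a b f = Lp_norm p a b \<phi>"
proof -
  have m: "\<phi> \<in> borel_measurable (lebesgue_on {a..b})" using \<phi> by (simp add: Lp_space_def)
  then obtain \<phi>' where ver: "borel_version a b \<phi> \<phi>'" using ex_borel_version by blast
  have "AE x in lebesgue_on {a..b}. \<phi> x = \<phi>' x" using ver by (simp add: borel_version_def)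
  with ae have "AE x in lebesgue_on {a..b}. f x = \<phi>' x" by eventually_elim simp
  with ver have "borel_version a b f \<phi>'" by (simp add: borel_version_def)
  then have f: "f \<in> borel_measurable (lebesgue_on {a..b})" by (rule borel_version_integral(3))
  have ae': "AE x in lebesgue_on {a..b}. \<bar>f x\<bar> powr p = \<bar>\<phi> x\<bar> powr p"
    using ae by eventually_elim simp
  have "integrable (lebesgue_on {a..b}) (\<lambda>x. \<bar>f x\<bar> powr p) \<longleftrightarrow> integrable (lebesgue_on {a..b}) (\<lambda>x. \<bar>\<phi> x\<bar> powr p)"
    using ae' f m by (intro integrable_cong_AE) auto
  then show "f \<in> Lp_space p a b" using \<phi> f by (simp add: Lp_space_def)
  have "(LINT x|lebesgue_on {a..b}. \<bar>f x\<bar> powr p) = (LINT x|lebesgue_on {a..b}. \<bar>\<phi> x\<bar> powr p)"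
    using ae' f m by (intro integral_cong_AE) auto
  then show "Lp_norm p a b f = Lp_norm p a b \<phi>" by (simp add: Lp_norm_def)
qed

text \<open>
  The inequality \<open>y \<le> 1 + y powr p\<close> at \<open>y = t / c\<close>. With the free scale \<open>c\<close> it replaces
  Hoelder's inequality at the price of a factor \<open>2\<close>.
\<close>

lemma le_weighted_powr:
  fixes t c p :: real
  assumes "0 < c" "0 \<le> t" "1 \<le> p"
  shows "t \<le> c + c / c powr p * t powr p"
proof -
  have "t / c \<le> 1 + (t / c) powr p"
  proof (cases "t \<le> c")
    case True
    then have "t / c \<le> 1" using assms by simp
    then show ?thesis using powr_ge_zero[of "t / c" p] by linarith
  next
    case False
    then have "1 \<le> t / c" using assms by simp
    then have "(t / c) powr 1 \<le> (t / c) powr p" using assms by (intro powr_mono) auto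
    moreover have "(t / c) powr 1 = t / c" using \<open>1 \<le> t / c\<close> by (intro powr_one) linarith
    ultimately show ?thesis by linarith
  qed
  then have "t \<le> c * (1 + (t / c) powr p)" using assms by (simp add: pos_divide_le_eq mult.commute)
  also have "\<dots> = c + c / c powr p * t powr p" using assms by (simp add: powr_divide algebra_simps)
  finally show ?thesis .
qed

text \<open>
  The second part is Hoelder's inequality with an additional factor \<open>2\<close>, raised to the power \<open>p\<close>: it
  bounds the \<open>L\<^sub>p\<close> norm of the constant function whose value is the \<open>L\<^sub>1\<close> norm of \<open>\<phi>\<close>. Integrating
  \<open>le_weighted_powr\<close> bounds the \<open>L\<^sub>1\<close> norm by \<open>c L + c N / c powr p\<close>, and the two terms balance for
  \<open>c powr p = N / L\<close>.
\<close>

lemma Lp_space_imp_L1: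
  assumes "a < b" "1 \<le> p" and \<phi>: "\<phi> \<in> Lp_space p a b"
  shows "integrable (lebesgue_on {a..b}) \<phi>"
    and "((LINT x|lebesgue_on {a..b}. \<bar>\<phi> x\<bar>) powr p) * (b - a)
      \<le> (2 * (b - a)) powr p * (LINT x|lebesgue_on {a..b}. \<bar>\<phi> x\<bar> powr p)"
proof -
  let ?I = "lebesgue_on {a..b}" and ?L = "b - a"
  let ?N = "LINT x|?I. \<bar>\<phi> x\<bar> powr p" and ?J = "LINT x|?I. \<bar>\<phi> x\<bar>"
  have m: "\<phi> \<in> borel_measurable ?I" and ip: "integrable ?I (\<lambda>x. \<bar>\<phi> x\<bar> powr p)"
    using \<phi> by (auto simp: Lp_space_def)
  have ib: "integrable ?I (\<lambda>x. c + d * \<bar>\<phi> x\<bar> powr p)" for c d :: real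
    using ip by auto
  show int: "integrable ?I \<phi>"
    by (rule Bochner_Integration.integrable_bound[OF ib[of 1 1] m])
      (use le_weighted_powr[of 1 "\<bar>\<phi> _\<bar>" p] \<open>1 \<le> p\<close> in \<open>auto intro!: AE_I2\<close>)
  have J0: "0 \<le> ?J" and N0: "0 \<le> ?N" by (simp_all add: integral_nonneg_AE)
  have L: "0 < ?L" using \<open>a < b\<close> by simp
  have J: "?J \<le> c * ?L + c / c powr p * ?N" if "0 < c" for c
  proof -
    have "?J \<le> (LINT x|?I. c + c / c powr p * \<bar>\<phi> x\<bar> powr p)"
      by (intro integral_mono ib le_weighted_powr that \<open>1 \<le> p\<close>) (use int in auto)
    also have "\<dots> = c * ?L + c / c powr p * ?N"
      using ip \<open>a < b\<close> by (simp add: measure_lebesgue_on_Icc mult.commute)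
    finally show ?thesis .
  qed
  show "?J powr p * ?L \<le> (2 * ?L) powr p * ?N"
  proof (cases "?N = 0")
    case True
    have "?J \<le> 0"
    proof (rule ccontr)
      assume "\<not> ?J \<le> 0"
      then have pos: "0 < ?J / (2 * ?L)" using L by simp
      have half: "?J / (2 * ?L) * ?L = ?J / 2" using L by (simp add: field_simps)
      have "?J \<le> ?J / 2"
        using J[OF pos] by (simp only: True half mult_zero_right add_0_right)
      then show False using \<open>\<not> ?J \<le> 0\<close> by linarith
    qed
    then have "?J = 0" using J0 by simp
    then show ?thesis by (simp add: True)
  next
    case False
    then have N: "0 < ?N" using N0 by linarith
    define c where "c = (?N / ?L) powr (1 / p)"
    have "c powr p = ?N / ?L" using N L \<open>1 \<le> p\<close> by (simp add: c_def powr_powr)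
    moreover have c: "0 < c" using N L by (simp add: c_def)
    ultimately have "c / c powr p * ?N = c * ?L" using N by simp
    then have "?J \<le> c * ?L + c * ?L" using J[OF c] by (simp only:)
    then have "?J \<le> 2 * ?L * c" by (simp add: algebra_simps)
    then have "?J powr p \<le> (2 * ?L * c) powr p" using J0 \<open>1 \<le> p\<close> by (intro powr_mono2) auto
    also have "\<dots> = (2 * ?L) powr p * (?N / ?L)"
      using L c \<open>c powr p = ?N / ?L\<close> by (simp add: powr_mult)
    finally show ?thesis using L by (simp add: field_simps)
  qed
qed

text \<open>
  The two summands are separated by \<open>x + y \<le> 2 max x y\<close> instead of Minkowski's inequality. This costs a
  constant factor that stays bounded as \<open>p\<close> varies.
\<close>

lemma Lp_norm_dominated:
  assumes "a < b" "1 \<le> p" and \<phi>: "\<phi> \<in> Lp_space p a b"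
    and f: "f \<in> borel_measurable (lebesgue_on {a..b})" and "0 \<le> A" "0 \<le> B"
    and dom: "AE x in lebesgue_on {a..b}. \<bar>f x\<bar> \<le> A * \<bar>\<phi> x\<bar> + B * (LINT s|lebesgue_on {a..b}. \<bar>\<phi> s\<bar>)"
  shows "f \<in> Lp_space p a b" and "Lp_norm p a b f \<le> 4 * (A + 2 * B * (b - a)) * Lp_norm p a b \<phi>"
proof -
  let ?I = "lebesgue_on {a..b}" and ?L = "b - a"
  let ?N = "LINT x|?I. \<bar>\<phi> x\<bar> powr p" and ?J = "LINT x|?I. \<bar>\<phi> x\<bar>"
  let ?D = "A + 2 * B * ?L"
  have ip: "integrable ?I (\<lambda>x. \<bar>\<phi> x\<bar> powr p)" using \<phi> by (auto simp: Lp_space_def)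
  have L: "0 < ?L" using \<open>a < b\<close> by simp
  have J0: "0 \<le> ?J" and N0: "0 \<le> ?N" by (simp_all add: integral_nonneg_AE)
  have D0: "0 \<le> ?D" using assms by simp
  let ?h = "\<lambda>x. (2 * A) powr p * \<bar>\<phi> x\<bar> powr p + (2 * B * ?J) powr p"
  have ih: "integrable ?I ?h" using ip by auto
  have le: "AE x in ?I. \<bar>f x\<bar> powr p \<le> ?h x"
    using dom
  proof eventually_elim
    case (elim x)
    let ?s = "A * \<bar>\<phi> x\<bar>" and ?t = "B * ?J"
    have st: "0 \<le> ?s" "0 \<le> ?t" using assms J0 by auto
    have "\<bar>f x\<bar> powr p \<le> (2 * max ?s ?t) powr p"
      using elim st \<open>1 \<le> p\<close> by (intro powr_mono2) auto
    also have "\<dots> \<le> (2 * ?s) powr p + (2 * ?t) powr p"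
      by (cases "?s \<le> ?t") (auto simp: max_def)
    also have "\<dots> = ?h x" using assms J0 by (simp add: powr_mult mult.assoc)
    finally show ?case .
  qed
  have fp: "integrable ?I (\<lambda>x. \<bar>f x\<bar> powr p)"
    by (rule Bochner_Integration.integrable_bound[OF ih]) (use f le in \<open>auto elim!: eventually_mono\<close>)
  show "f \<in> Lp_space p a b" using f fp by (simp add: Lp_space_def)
  have "(LINT x|?I. \<bar>f x\<bar> powr p) \<le> (LINT x|?I. ?h x)"
    using fp ih le by (rule integral_mono_AE)
  also have "\<dots> = (2 * A) powr p * ?N + (2 * B) powr p * (?J powr p * ?L)"
    using ip \<open>a < b\<close> assms J0 by (simp add: measure_lebesgue_on_Icc powr_mult mult_ac)
  also have "\<dots> \<le> (2 * A) powr p * ?N + (2 * B) powr p * ((2 * ?L) powr p * ?N)"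
    using Lp_space_imp_L1(2)[OF \<open>a < b\<close> \<open>1 \<le> p\<close> \<phi>] by (intro add_left_mono mult_left_mono) auto
  also have "\<dots> = ((2 * A) powr p + (2 * (2 * B * ?L)) powr p) * ?N"
  proof -
    have "2 * (2 * B * ?L) = 2 * B * (2 * ?L)" by simp
    then have "(2 * (2 * B * ?L)) powr p = (2 * B) powr p * (2 * ?L) powr p"
      using \<open>0 \<le> B\<close> L by (simp only: powr_mult)
    then show ?thesis by (simp only: distrib_right mult.assoc)
  qed
  also have "\<dots> \<le> ((2 * ?D) powr p + (2 * ?D) powr p) * ?N"
    using assms L N0 by (intro mult_right_mono add_mono powr_mono2) auto
  also have "\<dots> \<le> (4 * ?D) powr p * ?N"
  proof -
    have "2 \<le> (2::real) powr p" using powr_mono[of 1 p 2] \<open>1 \<le> p\<close> by simp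
    then have "2 * (2 * ?D) powr p \<le> 2 powr p * (2 * ?D) powr p" by (intro mult_right_mono) auto
    also have "\<dots> = (4 * ?D) powr p" using D0 by (simp flip: powr_mult)
    finally show ?thesis using N0 by (intro mult_right_mono) auto
  qed
  finally have "(LINT x|?I. \<bar>f x\<bar> powr p) powr (1 / p) \<le> ((4 * ?D) powr p * ?N) powr (1 / p)"
    using \<open>1 \<le> p\<close> by (intro powr_mono2) (auto simp: integral_nonneg_AE)
  also have "\<dots> = 4 * ?D * ?N powr (1 / p)"
    using D0 N0 \<open>1 \<le> p\<close> by (simp add: powr_mult powr_powr)
  finally show "Lp_norm p a b f \<le> 4 * ?D * Lp_norm p a b \<phi>" by (simp add: Lp_norm_def)
qed

lemma Lp_norm_mult_exp_le:
  assumes "a < b" "1 \<le> p" and \<phi>: "\<phi> \<in> Lp_space p a b"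
  shows "(\<lambda>x. exp (\<sigma> * x) * \<phi> x) \<in> Lp_space p a b"
    and "Lp_norm p a b (\<lambda>x. exp (\<sigma> * x) * \<phi> x) \<le> 4 * exp_bound a b \<sigma> * Lp_norm p a b \<phi>"
proof -
  have "(\<lambda>x. exp (\<sigma> * x) * \<phi> x) \<in> borel_measurable (lebesgue_on {a..b})"
  proof -
    have "(\<lambda>x. exp (\<sigma> * x)) \<in> borel_measurable (lebesgue_on {a..b})"
      by (intro continuous_imp_measurable_on_sets_lebesgue continuous_intros) auto
    moreover have "\<phi> \<in> borel_measurable (lebesgue_on {a..b})" using \<phi> by (simp add: Lp_space_def)
    ultimately show ?thesis by (rule borel_measurable_times)
  qed
  moreover have "AE x in lebesgue_on {a..b}. \<bar>exp (\<sigma> * x) * \<phi> x\<bar>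
      \<le> exp_bound a b \<sigma> * \<bar>\<phi> x\<bar> + 0 * (LINT s|lebesgue_on {a..b}. \<bar>\<phi> s\<bar>)"
    by (rule AE_I2) (auto simp: abs_mult intro!: mult_right_mono exp_le_exp_bound)
  moreover have "0 \<le> exp_bound a b \<sigma>" by (simp add: exp_bound_def)
  ultimately show "(\<lambda>x. exp (\<sigma> * x) * \<phi> x) \<in> Lp_space p a b"
    "Lp_norm p a b (\<lambda>x. exp (\<sigma> * x) * \<phi> x) \<le> 4 * exp_bound a b \<sigma> * Lp_norm p a b \<phi>"
    using Lp_norm_dominated[OF assms, of "\<lambda>x. exp (\<sigma> * x) * \<phi> x" "exp_bound a b \<sigma>" 0] by auto
qed

text \<open>
  The chosen density agrees with the fractional derivative almost everywhere, so the norm is that of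
  the derivative.
\<close>

lemma frac_norm_eq_Lp_norm_frac_deriv:
  assumes "a < b" "0 < \<alpha>" "1 \<le> p" and u: "u \<in> frac_space a b \<alpha> p"
  shows "frac_deriv a \<alpha> u \<in> Lp_space p a b"
    and "frac_norm a b \<alpha> p u = Lp_norm p a b (frac_deriv a \<alpha> u)"
proof -
  define \<phi> where "\<phi> = (SOME \<phi>. \<phi> \<in> Lp_space p a b \<and> is_frac_int_of a b \<alpha> u \<phi>)"
  have "\<exists>\<phi>. \<phi> \<in> Lp_space p a b \<and> is_frac_int_of a b \<alpha> u \<phi>"
    using u by (auto simp: frac_space_def)
  then have \<phi>: "\<phi> \<in> Lp_space p a b" "is_frac_int_of a b \<alpha> u \<phi>"
    unfolding \<phi>_def by (rule someI2_ex, blast)+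
  have "AE x in lebesgue_on {a..b}. frac_deriv a \<alpha> u x = \<phi> x"
    using \<open>0 < \<alpha>\<close> Lp_space_imp_L1(1)[OF \<open>a < b\<close> \<open>1 \<le> p\<close> \<phi>(1)] \<phi>(2) by (rule frac_deriv_frac_int)
  from Lp_space_cong_AE[OF \<phi>(1) this]
  show "frac_deriv a \<alpha> u \<in> Lp_space p a b" "frac_norm a b \<alpha> p u = Lp_norm p a b (frac_deriv a \<alpha> u)"
    by (simp_all add: frac_norm_def \<phi>_def)
qed

definition temper_const :: "real \<Rightarrow> real \<Rightarrow> real \<Rightarrow> real \<Rightarrow> real" where
  "temper_const a b \<alpha> \<sigma> =
     4 * (exp_bound a b \<sigma> + 2 * (temper_bound \<alpha> \<sigma> (b - a) * exp_bound a b \<sigma>) * (b - a))"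

lemma temper_const_pos: "a < b \<Longrightarrow> 0 < \<alpha> \<Longrightarrow> 0 < temper_const a b \<alpha> \<sigma>"
  by (simp add: temper_const_def exp_bound_def temper_bound_nonneg add_pos_nonneg)

lemma frac_space_mult_exp:
  assumes "a < b" "0 < \<alpha>" "1 \<le> p" and u: "u \<in> frac_space a b \<alpha> p"
  shows "(\<lambda>x. exp (\<sigma> * x) * u x) \<in> frac_space a b \<alpha> p"
    and "frac_norm a b \<alpha> p (\<lambda>x. exp (\<sigma> * x) * u x) \<le> temper_const a b \<alpha> \<sigma> * frac_norm a b \<alpha> p u"
proof -
  obtain \<phi> where \<phi>: "\<phi> \<in> Lp_space p a b" "is_frac_int_of a b \<alpha> u \<phi>"
    using u by (auto simp: frac_space_def)
  have \<phi>1: "integrable (lebesgue_on {a..b}) \<phi>"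
    using \<open>a < b\<close> \<open>1 \<le> p\<close> \<phi>(1) by (rule Lp_space_imp_L1)
  obtain \<psi> where \<psi>: "\<psi> \<in> borel_measurable (lebesgue_on {a..b})"
    "is_frac_int_of a b \<alpha> (\<lambda>x. exp (\<sigma> * x) * u x) \<psi>"
    "AE x in lebesgue_on {a..b}. \<bar>\<psi> x\<bar> \<le> exp_bound a b \<sigma> * \<bar>\<phi> x\<bar>
       + temper_bound \<alpha> \<sigma> (b - a) * exp_bound a b \<sigma> * (LINT s|lebesgue_on {a..b}. \<bar>\<phi> s\<bar>)"
    using tempered_density[OF \<open>0 < \<alpha>\<close> \<phi>1 \<phi>(2), of \<sigma> thesis] by blast
  have nn: "0 \<le> exp_bound a b \<sigma>" "0 \<le> temper_bound \<alpha> \<sigma> (b - a) * exp_bound a b \<sigma>"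
    using \<open>0 < \<alpha>\<close> by (simp_all add: exp_bound_def temper_bound_nonneg)
  note dom = Lp_norm_dominated[OF \<open>a < b\<close> \<open>1 \<le> p\<close> \<phi>(1) \<psi>(1) nn \<psi>(3)]
  show eu: "(\<lambda>x. exp (\<sigma> * x) * u x) \<in> frac_space a b \<alpha> p"
    using dom(1) \<psi>(2) by (auto simp: frac_space_def)
  have norm_eq: "frac_norm a b \<alpha> p v = Lp_norm p a b \<theta>"
    if "\<theta> \<in> Lp_space p a b" "is_frac_int_of a b \<alpha> v \<theta>" for v \<theta>
  proof -
    have "v \<in> frac_space a b \<alpha> p" using that by (auto simp: frac_space_def)
    then have "frac_norm a b \<alpha> p v = Lp_norm p a b (frac_deriv a \<alpha> v)"
      using assms by (intro frac_norm_eq_Lp_norm_frac_deriv) auto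
    also have "\<dots> = Lp_norm p a b \<theta>"
      using that \<open>0 < \<alpha>\<close> Lp_space_imp_L1(1)[OF \<open>a < b\<close> \<open>1 \<le> p\<close>]
      by (intro Lp_space_cong_AE(2) frac_deriv_frac_int) auto
    finally show ?thesis .
  qed
  show "frac_norm a b \<alpha> p (\<lambda>x. exp (\<sigma> * x) * u x) \<le> temper_const a b \<alpha> \<sigma> * frac_norm a b \<alpha> p u"
    using dom(2) unfolding norm_eq[OF \<phi>] norm_eq[OF dom(1) \<psi>(2)] temper_const_def .
qed

theorem corollary2p22:
  fixes a b \<alpha> \<sigma> :: real
  assumes "a < b" and "\<alpha> > 0"
  shows "(\<forall>p\<ge>1. \<forall>u. u \<in> frac_space a b \<alpha> p \<longleftrightarrow> (\<lambda>x. exp (\<sigma> * x) * u x) \<in> frac_space a b \<alpha> p) \<and>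
    (\<exists>C1>0. \<exists>C2>0. \<forall>p\<ge>1. \<forall>u\<in>frac_space a b \<alpha> p.
        C1 * frac_norm a b \<alpha> p u \<le> frac_norm a b \<alpha> p (\<lambda>x. exp (\<sigma> * x) * u x) \<and>
        frac_norm a b \<alpha> p (\<lambda>x. exp (\<sigma> * x) * u x) \<le> C2 * frac_norm a b \<alpha> p u) \<and>
    (\<exists>C1>0. \<exists>C2>0. \<forall>p\<ge>1. \<forall>u\<in>frac_space a b \<alpha> p.
        frac_deriv a \<alpha> u \<in> Lp_space p a b \<and>
        tempered_deriv a \<alpha> \<sigma> u \<in> Lp_space p a b \<and>
        C1 * Lp_norm p a b (frac_deriv a \<alpha> u) \<le> Lp_norm p a b (tempered_deriv a \<alpha> \<sigma> u) \<and>
        Lp_norm p a b (tempered_deriv a \<alpha> \<sigma> u) \<le> C2 * Lp_norm p a b (frac_deriv a \<alpha> u))"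
proof -
  let ?e = "\<lambda>u x. exp (\<sigma> * x) * u x :: real"
  let ?T = "temper_const a b \<alpha>"
  let ?c1 = "1 / ?T (- \<sigma>)" and ?c2 = "?T \<sigma>"
  have T: "0 < ?T \<tau>" for \<tau> using assms by (rule temper_const_pos)
  have E: "0 < exp_bound a b \<tau>" for \<tau> by (simp add: exp_bound_def)
  \<comment> \<open>Weighting by \<open>- \<sigma>\<close> inverts weighting by \<open>\<sigma>\<close>, so each upper bound for \<open>- \<sigma>\<close> is a lower bound for \<open>\<sigma>\<close>.\<close>
  have undo: "(\<lambda>x. exp (- \<sigma> * x) * ?e u x) = u" for u
    by (simp flip: exp_add add: mult.assoc[symmetric])
  have space: "u \<in> frac_space a b \<alpha> p \<longleftrightarrow> ?e u \<in> frac_space a b \<alpha> p" if "1 \<le> p" for p u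
    using frac_space_mult_exp(1)[OF assms that, of u \<sigma>] frac_space_mult_exp(1)[OF assms that, of "?e u" "- \<sigma>"]
    unfolding undo by blast
  have upper: "frac_norm a b \<alpha> p (?e u) \<le> ?c2 * frac_norm a b \<alpha> p u"
    and lower: "?c1 * frac_norm a b \<alpha> p u \<le> frac_norm a b \<alpha> p (?e u)"
    if "1 \<le> p" "u \<in> frac_space a b \<alpha> p" for p u
  proof -
    show "frac_norm a b \<alpha> p (?e u) \<le> ?c2 * frac_norm a b \<alpha> p u"
      by (rule frac_space_mult_exp(2)[OF assms that])
    have "frac_norm a b \<alpha> p u \<le> ?T (- \<sigma>) * frac_norm a b \<alpha> p (?e u)"
      using frac_space_mult_exp(2)[OF assms that(1), of "?e u" "- \<sigma>"] space[OF that(1), of u] that(2)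
      unfolding undo by simp
    then show "?c1 * frac_norm a b \<alpha> p u \<le> frac_norm a b \<alpha> p (?e u)"
      using T[of "- \<sigma>"] by (simp add: divide_le_eq mult.commute)
  qed
  let ?d1 = "?c1 / (4 * exp_bound a b \<sigma>)" and ?d2 = "4 * exp_bound a b (- \<sigma>) * ?c2"
  have deriv: "frac_deriv a \<alpha> u \<in> Lp_space p a b \<and> tempered_deriv a \<alpha> \<sigma> u \<in> Lp_space p a b \<and>
      ?d1 * Lp_norm p a b (frac_deriv a \<alpha> u) \<le> Lp_norm p a b (tempered_deriv a \<alpha> \<sigma> u) \<and>
      Lp_norm p a b (tempered_deriv a \<alpha> \<sigma> u) \<le> ?d2 * Lp_norm p a b (frac_deriv a \<alpha> u)"
    if p: "1 \<le> p" and u: "u \<in> frac_space a b \<alpha> p" for p u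
  proof -
    let ?w = "frac_deriv a \<alpha> (?e u)"
    have eu: "?e u \<in> frac_space a b \<alpha> p" using space[OF p] u by blast
    note du = frac_norm_eq_Lp_norm_frac_deriv[OF assms p u] and dw = frac_norm_eq_Lp_norm_frac_deriv[OF assms p eu]
    have t: "tempered_deriv a \<alpha> \<sigma> u = (\<lambda>x. exp (- \<sigma> * x) * ?w x)"
      by (simp add: tempered_deriv_def fun_eq_iff)
    note tw = Lp_norm_mult_exp_le[OF \<open>a < b\<close> p dw(1), of "- \<sigma>", folded t]
    have w: "?w = (\<lambda>x. exp (\<sigma> * x) * tempered_deriv a \<alpha> \<sigma> u x)"
      unfolding t by (simp add: mult.assoc[symmetric] flip: exp_add)
    have wt: "Lp_norm p a b ?w \<le> 4 * exp_bound a b \<sigma> * Lp_norm p a b (tempered_deriv a \<alpha> \<sigma> u)"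
      using Lp_norm_mult_exp_le(2)[OF \<open>a < b\<close> p tw(1), of \<sigma>] by (simp only: w[symmetric])
    have "?c1 * Lp_norm p a b (frac_deriv a \<alpha> u) \<le> Lp_norm p a b ?w"
      using lower[OF p u] by (simp only: du(2) dw(2))
    also note wt
    finally have "?c1 * Lp_norm p a b (frac_deriv a \<alpha> u)
        \<le> 4 * exp_bound a b \<sigma> * Lp_norm p a b (tempered_deriv a \<alpha> \<sigma> u)" .
    moreover have "k * x \<le> 4 * e * y \<Longrightarrow> 0 < e \<Longrightarrow> k / (4 * e) * x \<le> y" for k x e y :: real
      by (simp add: pos_divide_le_eq mult_ac)
    ultimately have "?d1 * Lp_norm p a b (frac_deriv a \<alpha> u) \<le> Lp_norm p a b (tempered_deriv a \<alpha> \<sigma> u)"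
      using E by blast
    moreover have "Lp_norm p a b (tempered_deriv a \<alpha> \<sigma> u) \<le> ?d2 * Lp_norm p a b (frac_deriv a \<alpha> u)"
    proof -
      have "Lp_norm p a b ?w \<le> ?c2 * Lp_norm p a b (frac_deriv a \<alpha> u)"
        using upper[OF p u] by (simp only: du(2) dw(2))
      then have "4 * exp_bound a b (- \<sigma>) * Lp_norm p a b ?w
          \<le> 4 * exp_bound a b (- \<sigma>) * (?c2 * Lp_norm p a b (frac_deriv a \<alpha> u))"
        using E[of "- \<sigma>"] by (intro mult_left_mono) auto
      with tw(2) show ?thesis by (simp add: mult.assoc)
    qed
    ultimately show ?thesis using du(1) tw(1) by blast
  qed
  have pos: "0 < ?c1" "0 < ?c2" "0 < ?d1" "0 < ?d2" using T E by simp_all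
  show ?thesis
  proof (intro conjI)
    show "\<forall>p\<ge>1. \<forall>u. u \<in> frac_space a b \<alpha> p \<longleftrightarrow> ?e u \<in> frac_space a b \<alpha> p"
      using space by blast
    show "\<exists>C1>0. \<exists>C2>0. \<forall>p\<ge>1. \<forall>u\<in>frac_space a b \<alpha> p.
        C1 * frac_norm a b \<alpha> p u \<le> frac_norm a b \<alpha> p (?e u) \<and>
        frac_norm a b \<alpha> p (?e u) \<le> C2 * frac_norm a b \<alpha> p u"
      by (rule exI[of _ ?c1], rule conjI[OF pos(1)], rule exI[of _ ?c2], rule conjI[OF pos(2)])
        (use upper lower in blast)
    show "\<exists>C1>0. \<exists>C2>0. \<forall>p\<ge>1. \<forall>u\<in>frac_space a b \<alpha> p.
        frac_deriv a \<alpha> u \<in> Lp_space p a b \<and> tempered_deriv a \<alpha> \<sigma> u \<in> Lp_space p a b \<and>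
        C1 * Lp_norm p a b (frac_deriv a \<alpha> u) \<le> Lp_norm p a b (tempered_deriv a \<alpha> \<sigma> u) \<and>
        Lp_norm p a b (tempered_deriv a \<alpha> \<sigma> u) \<le> C2 * Lp_norm p a b (frac_deriv a \<alpha> u)"
      by (rule exI[of _ ?d1], rule conjI[OF pos(3)], rule exI[of _ ?d2], rule conjI[OF pos(4)])
        (use deriv in blast)
  qed
qed

end
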